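(* Let $\Pi$ be a self-contained $k$-witness problem, and suppose we have access to a randomised decision oracle for $\Pi$ whose probability of returning an incorrect answer is at most $c < \frac{1}{2}$ (independently on each call). There is a randomised algorithm which takes as input an instance of $\Pi$ (with universe of size $n$) and a constant $\epsilon > 0$, and outputs a list of witnesses of the instance such that, for any witness $W$, the probability that $W$ is included in the list is at least $1 - \epsilon$. Moreover, in expectation the algorithm makes at most $2^{O(k)} \cdot \log^3 n \cdot N$ oracle calls, where $N$ is the total number of witnesses in the instance, and if an oracle call can be executed in time $g(k)\cdot n^{O(1)}$ for some computable function $g$, then the expected running time of the algorithm is $2^{O(k)} \cdot g(k) \cdot n^{O(1)} \cdot N$.
   Context: A self-contained $k$-witness problem is one in which an instance consists of a universe $U$ of $n$ elements and a parameter $k$, together with a (implicitly specified) collection of $k$-element subsets of $U$ called witnesses, such that a decision procedure may be called on any subset $X \subseteq U$ to determine whether some witness of the original instance is contained in $X$. A randomised decision oracle for $\Pi$ takes $X \subseteq U$ and is intended to return $1$ if some witness $W$ satisfies $W \subseteq X$ and $0$ otherwise; on each call it returns the incorrect answer with probability at most $c$, independently of other calls.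
   Formalization: Since the oracle can err both ways, the list consists only of witnesses with probability at least 1-ε (always, if the oracle never falsely accepts a k-set); in the bounds n is read as max(2,n) and N as max(1,N); ε is rational. *)

theory Defs
  imports "HOL-Probability.Probability" "HOL-Library.Landau_Symbols"
begin

section \<open>Witness problems and randomised decision oracles\<close>

text \<open>
  A problem is a set of instances of an arbitrary type. The \<open>n\<close>-element universe of an
  instance is represented by \<open>{..<n}\<close>.
\<close>

record 'i problem =
  instances :: "'i set"
  univ_size :: "'i \<Rightarrow> nat"
  param :: "'i \<Rightarrow> nat"
  witnesses :: "'i \<Rightarrow> nat set set"

definition k_witness_problem :: "'i problem \<Rightarrow> bool" where
  "k_witness_problem \<P> \<longleftrightarrow>
     (\<forall>I\<in>instances \<P>. \<forall>W\<in>witnesses \<P> I. W \<subseteq> {..<univ_size \<P> I} \<and> card W = param \<P> I)"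

definition has_witness :: "'i problem \<Rightarrow> 'i \<Rightarrow> nat set \<Rightarrow> bool" where
  "has_witness \<P> I X \<longleftrightarrow> (\<exists>W\<in>witnesses \<P> I. W \<subseteq> X)"

text \<open>
  \<open>answer \<O> I i X\<close> is the distribution of the answer to the query \<open>X\<close> when it is made as the
  \<open>i\<close>-th call on the instance \<open>I\<close>, and \<open>call_time \<O> I i X\<close> is the time taken by that call.
  The error probability may differ from call to call. Independence of the calls is built into
  the semantics of programs below, where each call draws a fresh sample.
\<close>

record 'i decision_oracle =
  answer :: "'i \<Rightarrow> nat \<Rightarrow> nat set \<Rightarrow> bool pmf"
  call_time :: "'i \<Rightarrow> nat \<Rightarrow> nat set \<Rightarrow> nat"

definition randomised_decision_oracle :: "'i problem \<Rightarrow> 'i decision_oracle \<Rightarrow> real \<Rightarrow> bool" where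
  "randomised_decision_oracle \<P> \<O> c \<longleftrightarrow>
     (\<forall>I\<in>instances \<P>. \<forall>i. \<forall>X\<subseteq>{..<univ_size \<P> I}.
        pmf (answer \<O> I i X) (\<not> has_witness \<P> I X) \<le> c \<and> 0 < call_time \<O> I i X)"

text \<open>
  No false positives on sets of exactly \<open>k\<close> elements. If this fails, every pattern of answers can
  have positive probability on every instance, so no algorithm that lists each witness with
  positive probability can be certain never to list a non-witness.
\<close>

definition verifies_candidates :: "'i problem \<Rightarrow> 'i decision_oracle \<Rightarrow> 'i \<Rightarrow> bool" where
  "verifies_candidates \<P> \<O> I \<longleftrightarrow>
     (\<forall>i. \<forall>X\<subseteq>{..<univ_size \<P> I}. card X = param \<P> I \<longrightarrow> X \<notin> witnesses \<P> I \<longrightarrow>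
        pmf (answer \<O> I i X) True = 0)"


section \<open>Randomised programs with calls to a decision procedure\<close>

text \<open>
  The machine model is a random access machine with registers and arrays of natural numbers,
  whose only arithmetic operations are addition and truncated subtraction, extended by fair coin
  flips, decision calls and output. Without multiplication the bit length of all numbers is at most
  linear in the number of steps and the input length, so charging one step per command gives running times that are
  polynomially related to those of Turing machines. (The expressions in a fixed program have
  bounded size, so charging for each operation would only change a constant factor.)
\<close>

datatype aexp =
    Const nat
  | Reg nat
  | Arr nat aexp
  | Plus aexp aexp
  | Minus aexp aexp

datatype bexp =
    Less aexp aexp
  | Neg bexp
  | Conj bexp bexp

text \<open>
  The array \<open>a\<close> in \<open>Query x a\<close> and \<open>Emit a\<close> is the characteristic function of a subset of the
  universe. The former stores the answer in register \<open>x\<close>, the latter appends the set to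
  the output list.
\<close>

datatype com =
    Skip
  | Assign nat aexp
  | Store nat aexp aexp
  | Coin nat
  | Query nat nat
  | Emit nat
  | Seq com com
  | Cond bexp com com
  | While bexp com

record state =
  regs :: "nat \<Rightarrow> nat"
  arrs :: "nat \<Rightarrow> nat \<Rightarrow> nat"
  listed :: "nat set list"
  calls :: nat
  steps :: nat

primrec aval :: "aexp \<Rightarrow> state \<Rightarrow> nat" where
  "aval (Const m) s = m"
| "aval (Reg x) s = regs s x"
| "aval (Arr a e) s = arrs s a (aval e s)"
| "aval (Plus e e') s = aval e s + aval e' s"
| "aval (Minus e e') s = aval e s - aval e' s"

primrec bval :: "bexp \<Rightarrow> state \<Rightarrow> bool" where
  "bval (Less e e') s \<longleftrightarrow> aval e s < aval e' s"
| "bval (Neg b) s \<longleftrightarrow> \<not> bval b s"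
| "bval (Conj b b') s \<longleftrightarrow> bval b s \<and> bval b' s"

definition charge :: "nat \<Rightarrow> state \<Rightarrow> state" where
  "charge t s = s\<lparr>steps := steps s + t\<rparr>"

definition set_reg :: "nat \<Rightarrow> nat \<Rightarrow> state \<Rightarrow> state" where
  "set_reg x v s = s\<lparr>regs := (regs s)(x := v)\<rparr>"

definition set_arr :: "nat \<Rightarrow> nat \<Rightarrow> nat \<Rightarrow> state \<Rightarrow> state" where
  "set_arr a j v s = s\<lparr>arrs := (arrs s)(a := (arrs s a)(j := v))\<rparr>"

definition array_set :: "nat \<Rightarrow> nat \<Rightarrow> state \<Rightarrow> nat set" where
  "array_set n a s = {j. j < n \<and> arrs s a j \<noteq> 0}"

partial_function (spmf) while_spmf :: "('s \<Rightarrow> bool) \<Rightarrow> ('s \<Rightarrow> 's spmf) \<Rightarrow> 's \<Rightarrow> 's spmf" where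
  "while_spmf b f s = (if b s then bind_spmf (f s) (while_spmf b f) else return_spmf s)"

text \<open>
  \<open>exec n ans t P s\<close> is the subdistribution of final states of \<open>P\<close> started in \<open>s\<close>, on a universe
  of size \<open>n\<close> and with decision calls with answers \<open>ans\<close> and call times \<open>t\<close>. Its missing mass is the
  probability of nontermination.
\<close>

primrec exec ::
  "nat \<Rightarrow> (nat \<Rightarrow> nat set \<Rightarrow> bool pmf) \<Rightarrow> (nat \<Rightarrow> nat set \<Rightarrow> nat) \<Rightarrow> com \<Rightarrow> state \<Rightarrow> state spmf"
where
  "exec n ans t Skip = (\<lambda>s. return_spmf (charge 1 s))"
| "exec n ans t (Assign x e) = (\<lambda>s. return_spmf (charge 1 (set_reg x (aval e s) s)))"
| "exec n ans t (Store a e e') =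
     (\<lambda>s. return_spmf (charge 1 (set_arr a (aval e s) (aval e' s) s)))"
| "exec n ans t (Coin x) =
     (\<lambda>s. map_spmf (\<lambda>b. charge 1 (set_reg x (of_bool b) s)) (spmf_of_pmf (bernoulli_pmf (1/2))))"
| "exec n ans t (Query x a) =
     (\<lambda>s. map_spmf
        (\<lambda>b. charge (t (calls s) (array_set n a s))
               (set_reg x (of_bool b) (s\<lparr>calls := calls s + 1\<rparr>)))
        (spmf_of_pmf (ans (calls s) (array_set n a s))))"
| "exec n ans t (Emit a) =
     (\<lambda>s. return_spmf (charge (n + 1) (s\<lparr>listed := listed s @ [array_set n a s]\<rparr>)))"
| "exec n ans t (Seq P Q) = (\<lambda>s. bind_spmf (exec n ans t P s) (exec n ans t Q))"
| "exec n ans t (Cond b P Q) =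
     (\<lambda>s. if bval b s then exec n ans t P (charge 1 s) else exec n ans t Q (charge 1 s))"
| "exec n ans t (While b P) =
     (\<lambda>s. map_spmf (charge 1) (while_spmf (bval b) (\<lambda>s. exec n ans t P (charge 1 s)) s))"

text \<open>The input is placed in the first registers; everything else is initially 0.\<close>

definition init :: "nat list \<Rightarrow> state" where
  "init xs = \<lparr>regs = (\<lambda>x. if x < length xs then xs ! x else 0), arrs = (\<lambda>_ _. 0),
     listed = [], calls = 0, steps = 0\<rparr>"

text \<open>
  An algorithm for a witness problem receives \<open>n\<close>, \<open>k\<close> and \<open>\<epsilon> = p / q\<close>; it can access the
  witnesses of the instance through decision calls only.
\<close>

definition run :: "'i problem \<Rightarrow> 'i decision_oracle \<Rightarrow> com \<Rightarrow> 'i \<Rightarrow> nat \<Rightarrow> nat \<Rightarrow> state spmf" where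
  "run \<P> \<O> P I p q =
     exec (univ_size \<P> I) (answer \<O> I) (call_time \<O> I) P
       (init [univ_size \<P> I, param \<P> I, p, q])"

definition expected :: "(state \<Rightarrow> nat) \<Rightarrow> state spmf \<Rightarrow> ennreal" where
  "expected f M = (\<integral>\<^sup>+ s. of_nat (f s) \<partial>measure_spmf M)"

text \<open>
  Computability in the same machine model; decision calls are always answered by no.
\<close>

definition computable :: "(nat \<Rightarrow> nat) \<Rightarrow> bool" where
  "computable g \<longleftrightarrow>
     (\<exists>P. \<forall>k. map_spmf (\<lambda>s. regs s 0)
               (exec 0 (\<lambda>_ _. return_pmf False) (\<lambda>_ _. 1) P (init [k])) = return_spmf (g k))"


section \<open>Complexity bounds\<close>

text \<open>
  The maxima only affect degenerate instances (\<open>n \<le> 1\<close> or no witnesses), for which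
  \<open>log n\<close>, \<open>n\<^sup>d\<close> or \<open>N\<close> can be 0 although no algorithm can work in time 0.
\<close>

definition size' :: "'i problem \<Rightarrow> 'i \<Rightarrow> nat" where
  "size' \<P> I = max 2 (univ_size \<P> I)"

definition num_witnesses' :: "'i problem \<Rightarrow> 'i \<Rightarrow> nat" where
  "num_witnesses' \<P> I = max 1 (card (witnesses \<P> I))"

end

theory Submission
  imports Defs
begin

text \<open>
  The algorithm explores a tree of random subsets of the universe depth first. Each node \<open>X\<close> has
  \<open>2 ^ k\<close> children, which are independent uniformly random subsets of \<open>X\<close>, and only the children
  on which the oracle answers yes (by a majority vote) are expanded. A child of a node that contains a
  witness contains the same witness with probability \<open>2 ^ -k\<close>, so the nodes containing a fixed witness
  form a critical branching process: the expected number of nodes at each depth is at most about \<open>N\<close>,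
  while a fixed witness survives for \<open>D\<close> generations with probability at least \<open>1 / (D + 1)\<close>.
  For \<open>D\<close> of order \<open>log n\<close> a surviving node is likely to consist of the witness alone. Repeating the
  search \<open>O(D)\<close> times finds every witness with the required probability, and majority votes of length
  \<open>O(k log n)\<close> make errors negligible; these are the three factors \<open>log n\<close>.

  Cost, false positives and misses are all bounded from above by supermartingales of the main loop.
\<close>

section \<open>A calculus for randomised programs\<close>

text \<open>The error probability of a call may depend on its index, hence on everything explored
  before, so the miss probabilities of the subtrees of a node cannot simply be multiplied by appeal
  to independence. Every bound is therefore a function of the machine state, namely of the current
  branch with its numbers of unexplored children, whose expectation does not increase in one
  iteration whatever the call index is; the product over the branch in \<open>miss\<close> replaces
  independence. The estimates reach the random child and the vote through
  \<open>wp_search_body\<close>, where a wrong vote costs its damage times \<open>\<delta>\<close>.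
  This damage must be paid for although the program does not know \<open>N\<close>, so the vote
  length is based on \<open>N \<le> n^k\<close>. Diverging runs contribute nothing to the
  expectations: upper bounds hold without termination, and termination follows from the potential
  that also bounds the cost.\<close>

lemma nn_integral_bind_spmf:
  "(\<integral>\<^sup>+ x. f x \<partial>measure_spmf (bind_spmf p h)) = (\<integral>\<^sup>+ y. (\<integral>\<^sup>+ x. f x \<partial>measure_spmf (h y)) \<partial>measure_spmf p)"
  unfolding measure_spmf_bind o_def
  by (rule nn_integral_bind[where B = "count_space UNIV"]) auto

lemma nn_integral_return_spmf: "(\<integral>\<^sup>+ x. f x \<partial>measure_spmf (return_spmf y)) = f y"
  by (simp add: measure_spmf_return_spmf nn_integral_return)

text \<open>The chain need not be a sequence; monotone convergence still applies because everything
  lives on the countable support of the lub.\<close>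

lemma nn_integral_lub_spmf:
  assumes chain: "Complete_Partial_Order.chain (ord_spmf (=)) Y" and "Y \<noteq> {}"
  shows "(\<integral>\<^sup>+ x. f x \<partial>measure_spmf (lub_spmf Y)) = (SUP p\<in>Y. \<integral>\<^sup>+ x. f x \<partial>measure_spmf p)"
proof -
  let ?M = "count_space (set_spmf (lub_spmf Y))"
  have "(\<integral>\<^sup>+ x. f x \<partial>measure_spmf (lub_spmf Y)) = (\<integral>\<^sup>+ x. (SUP p\<in>Y. ennreal (spmf p x) * f x) \<partial>?M)"
    by (simp add: nn_integral_measure_spmf' ennreal_spmf_lub_spmf assms SUP_mult_right_ennreal)
  also have "\<dots> = (SUP p\<in>Y. \<integral>\<^sup>+ x. ennreal (spmf p x) * f x \<partial>?M)"
  proof (rule nn_integral_monotone_convergence_SUP_countable)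
    have "Complete_Partial_Order.chain (\<le>) ((\<lambda>g x. g x * f x) ` (\<lambda>p x. ennreal (spmf p x)) ` Y)"
      using chain_ord_spmf_eqD[OF chain]
      by (rule chain_imageI) (auto simp: le_fun_def intro: mult_right_mono)
    then show "Complete_Partial_Order.chain (\<le>) ((\<lambda>p x. ennreal (spmf p x) * f x) ` Y)"
      by (simp add: image_image)
  qed (use assms in simp_all)
  also have "\<dots> = (SUP p\<in>Y. \<integral>\<^sup>+ x. f x \<partial>measure_spmf p)"
    unfolding nn_integral_measure_spmf
    by (intro SUP_cong refl, simp add: nn_integral_count_space_indicator)
       (intro nn_integral_cong, auto split: split_indicator simp: set_lub_spmf[OF chain] spmf_eq_0_set_spmf)
  finally show ?thesis .
qed

lemma nn_integral_spmf_le_const: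
  assumes "\<And>x. x \<in> set_spmf p \<Longrightarrow> f x \<le> v"
  shows "(\<integral>\<^sup>+ x. f x \<partial>measure_spmf p) \<le> v"
proof -
  have "(\<integral>\<^sup>+ x. f x \<partial>measure_spmf p) \<le> (\<integral>\<^sup>+ x. v \<partial>measure_spmf p)"
    using assms by (intro nn_integral_mono_AE) simp
  also have "\<dots> \<le> v * 1"
    by (simp add: measure_spmf.subprob_emeasure_le_1[simplified] mult_left_le)
  finally show ?thesis by simp
qed

text \<open>Supermartingale rule, by fixpoint induction: an upper bound on a nonnegative integral
  passes to suprema of chains and holds trivially for the zero subdistribution.\<close>

lemma nn_integral_while_spmf_le:
  fixes h :: "'s \<Rightarrow> 's spmf"
  assumes inv: "\<And>s s'. I s \<Longrightarrow> b s \<Longrightarrow> s' \<in> set_spmf (h s) \<Longrightarrow> I s'"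
    and step: "\<And>s. I s \<Longrightarrow> b s \<Longrightarrow> (\<integral>\<^sup>+ s'. f s' \<partial>measure_spmf (h s)) \<le> f s"
    and exit: "\<And>s. I s \<Longrightarrow> \<not> b s \<Longrightarrow> g s \<le> f s"
    and "I s"
  shows "(\<integral>\<^sup>+ s'. g s' \<partial>measure_spmf (while_spmf b h s)) \<le> f s"
proof -
  have "\<forall>s. I s \<longrightarrow> (\<integral>\<^sup>+ s'. g s' \<partial>measure_spmf (while_spmf b h s)) \<le> f s"
  proof (induction rule: while_spmf.fixp_induct[case_names adm bot step])
    case adm
    show ?case
    proof (rule ccpo.admissibleI, unfold curry_def, intro allI impI)
      fix A :: "((('s \<Rightarrow> bool) \<times> ('s \<Rightarrow> 's spmf)) \<times> 's \<Rightarrow> 's spmf) set" and s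
      let ?Y = "{y. \<exists>w\<in>A. y = w ((b, h), s)}"
      assume chain: "Complete_Partial_Order.chain (fun_ord (ord_spmf (=))) A" and "A \<noteq> {}"
        and le: "\<forall>w\<in>A. \<forall>s. I s \<longrightarrow> (\<integral>\<^sup>+ s'. g s' \<partial>measure_spmf (w ((b, h), s))) \<le> f s" and "I s"
      have "Complete_Partial_Order.chain (ord_spmf (=)) ?Y"
        using chain unfolding Complete_Partial_Order.chain_def fun_ord_def by blast
      then have "(\<integral>\<^sup>+ s'. g s' \<partial>measure_spmf (fun_lub lub_spmf A ((b, h), s))) =
          (SUP p\<in>?Y. \<integral>\<^sup>+ s'. g s' \<partial>measure_spmf p)"
        unfolding fun_lub_def using \<open>A \<noteq> {}\<close> by (intro nn_integral_lub_spmf) auto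
      then show "(\<integral>\<^sup>+ s'. g s' \<partial>measure_spmf (fun_lub lub_spmf A ((b, h), s))) \<le> f s"
        using le \<open>I s\<close> by (auto intro!: SUP_least)
    qed
  next
    case bot
    then show ?case by simp
  next
    case (step w)
    show ?case
    proof (intro allI impI)
      fix s assume "I s"
      show "(\<integral>\<^sup>+ s'. g s' \<partial>measure_spmf (if b s then bind_spmf (h s) (w b h) else return_spmf s)) \<le> f s"
      proof (cases "b s")
        case True
        have "(\<integral>\<^sup>+ y. (\<integral>\<^sup>+ s'. g s' \<partial>measure_spmf (w b h y)) \<partial>measure_spmf (h s)) \<le> (\<integral>\<^sup>+ y. f y \<partial>measure_spmf (h s))"
          using step inv[OF \<open>I s\<close> True] by (intro nn_integral_mono_AE) simp
        also have "\<dots> \<le> f s"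
          using assms(2)[OF \<open>I s\<close> True] .
        finally show ?thesis
          using True by (simp add: nn_integral_bind_spmf)
      qed (use exit \<open>I s\<close> in \<open>simp add: nn_integral_return_spmf\<close>)
    qed
  qed
  then show ?thesis using \<open>I s\<close> by blast
qed

lemma set_while_spmf:
  assumes inv: "\<And>s s'. I s \<Longrightarrow> b s \<Longrightarrow> s' \<in> set_spmf (h s) \<Longrightarrow> I s'"
    and "I s" and s': "s' \<in> set_spmf (while_spmf b h s)"
  shows "I s' \<and> \<not> b s'"
proof -
  \<comment> \<open>A penalty with values 0 and infinity turns the quantitative rule into a
    statement about the support.\<close>
  let ?g = "\<lambda>s. if I s \<and> \<not> b s then 0 else \<infinity> :: ennreal"
  have "(\<integral>\<^sup>+ s'. ?g s' \<partial>measure_spmf (while_spmf b h s)) \<le> 0"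
    using inv \<open>I s\<close> by (intro nn_integral_while_spmf_le[where I = I]) auto
  then have "AE s' in measure_spmf (while_spmf b h s). ?g s' = 0"
    by (simp add: nn_integral_0_iff_AE)
  then have "?g s' = 0"
    using s' unfolding AE_measure_spmf_iff by blast
  then show ?thesis
    by (auto split: if_splits)
qed

text \<open>A loop diverging with probability \<open>w s\<close> satisfies \<open>w s = E (w s')\<close>, which together with the
  ranking condition gives \<open>m * w s \<le> V s\<close> by induction on \<open>m\<close>.\<close>

lemma lossless_while_spmf:
  fixes V :: "'s \<Rightarrow> ennreal"
  assumes inv: "\<And>s s'. I s \<Longrightarrow> b s \<Longrightarrow> s' \<in> set_spmf (h s) \<Longrightarrow> I s'"
    and lossless: "\<And>s. I s \<Longrightarrow> b s \<Longrightarrow> lossless_spmf (h s)"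
    and rank: "\<And>s. I s \<Longrightarrow> b s \<Longrightarrow> 1 + (\<integral>\<^sup>+ s'. V s' \<partial>measure_spmf (h s)) \<le> V s"
    and "I s" and fin: "V s < \<top>"
  shows "lossless_spmf (while_spmf b h s)"
proof -
  define w where "w s = pmf (while_spmf b h s) None" for s
  have w_step: "ennreal (w s) = (\<integral>\<^sup>+ s'. ennreal (w s') \<partial>measure_spmf (h s))" if "I s" "b s" for s
  proof -
    have "w s = pmf (h s) None + (\<integral>s'. w s' \<partial>measure_spmf (h s))"
      unfolding w_def using that by (subst while_spmf.simps) (simp add: pmf_bind_spmf_None)
    moreover have "integrable (measure_spmf (h s)) w"
      by (rule measure_spmf.integrable_const_bound[where B = 1]) (auto simp: w_def pmf_le_1)
    ultimately show ?thesis
      using lossless[OF that]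
      by (subst nn_integral_eq_integral) (auto simp: lossless_iff_pmf_None, simp add: w_def)
  qed
  have bound: "of_nat m * ennreal (w s) \<le> V s" if "I s" for m s
    using that
  proof (induction m arbitrary: s)
    case (Suc m)
    show ?case
    proof (cases "b s")
      case True
      have "of_nat (Suc m) * ennreal (w s) = ennreal (w s) + of_nat m * (\<integral>\<^sup>+ s'. ennreal (w s') \<partial>measure_spmf (h s))"
        using w_step[OF Suc.prems True] by (simp add: distrib_right)
      also have "\<dots> \<le> 1 + (\<integral>\<^sup>+ s'. V s' \<partial>measure_spmf (h s))"
      proof (rule add_mono)
        show "ennreal (w s) \<le> 1"
          by (simp add: w_def pmf_le_1)
        have "of_nat m * (\<integral>\<^sup>+ s'. ennreal (w s') \<partial>measure_spmf (h s)) = (\<integral>\<^sup>+ s'. of_nat m * ennreal (w s') \<partial>measure_spmf (h s))"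
          by (simp add: nn_integral_cmult)
        also have "\<dots> \<le> (\<integral>\<^sup>+ s'. V s' \<partial>measure_spmf (h s))"
          using Suc.IH inv[OF Suc.prems True] by (intro nn_integral_mono_AE) simp
        finally show "of_nat m * (\<integral>\<^sup>+ s'. ennreal (w s') \<partial>measure_spmf (h s)) \<le> (\<integral>\<^sup>+ s'. V s' \<partial>measure_spmf (h s))" .
      qed
      also have "\<dots> \<le> V s"
        using rank[OF Suc.prems True] .
      finally show ?thesis .
    next
      case False
      then show ?thesis
        unfolding w_def by (subst while_spmf.simps) simp
    qed
  qed simp
  obtain v where v: "V s = ennreal v" "0 \<le> v"
    using fin by (cases "V s") auto
  have "real m * w s \<le> v" for m
    using bound[OF \<open>I s\<close>, of m] v
    by (simp add: ennreal_of_nat_eq_real_of_nat flip: ennreal_mult')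
  then have "w s \<le> 0"
    by (metis ex_less_of_nat_mult not_le)
  then have "w s = 0"
    by (metis w_def pmf_nonneg order_antisym)
  then show ?thesis
    by (simp add: w_def lossless_iff_pmf_None)
qed

section \<open>Preexpectations and total correctness for the machine\<close>

locale machine =
  fixes n :: nat and ans :: "nat \<Rightarrow> nat set \<Rightarrow> bool pmf" and t :: "nat \<Rightarrow> nat set \<Rightarrow> nat"
begin

text \<open>The weakest preexpectation of McIver and Morgan; diverging runs contribute 0.\<close>

definition wp :: "com \<Rightarrow> (state \<Rightarrow> ennreal) \<Rightarrow> state \<Rightarrow> ennreal" where
  "wp P f s = (\<integral>\<^sup>+ s'. f s' \<partial>measure_spmf (exec n ans t P s))"

definition ensures :: "com \<Rightarrow> (state \<Rightarrow> bool) \<Rightarrow> state \<Rightarrow> bool" where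
  "ensures P Q s \<longleftrightarrow> lossless_spmf (exec n ans t P s) \<and> (\<forall>s'\<in>set_spmf (exec n ans t P s). Q s')"

lemma ensures_simps [simp]:
  "ensures Skip Q s \<longleftrightarrow> Q (charge 1 s)"
  "ensures (Assign x e) Q s \<longleftrightarrow> Q (charge 1 (set_reg x (aval e s) s))"
  "ensures (Store a e e') Q s \<longleftrightarrow> Q (charge 1 (set_arr a (aval e s) (aval e' s) s))"
  "ensures (Coin x) Q s \<longleftrightarrow> (\<forall>b. Q (charge 1 (set_reg x (of_bool b) s)))"
  "ensures (Query x a) Q s \<longleftrightarrow> (\<forall>b\<in>set_pmf (ans (calls s) (array_set n a s)).
     Q (charge (t (calls s) (array_set n a s)) (set_reg x (of_bool b) (s\<lparr>calls := calls s + 1\<rparr>))))"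
  "ensures (Emit a) Q s \<longleftrightarrow> Q (charge (n + 1) (s\<lparr>listed := listed s @ [array_set n a s]\<rparr>))"
  "ensures (Seq P P') Q s \<longleftrightarrow> ensures P (ensures P' Q) s"
  "ensures (Cond b P P') Q s \<longleftrightarrow> (if bval b s then ensures P Q (charge 1 s) else ensures P' Q (charge 1 s))"
  by (auto simp: ensures_def set_pmf_bernoulli set_bind_spmf bind_UNION)

lemma wp_simps [simp]:
  "wp Skip f s = f (charge 1 s)"
  "wp (Assign x e) f s = f (charge 1 (set_reg x (aval e s) s))"
  "wp (Store a e e') f s = f (charge 1 (set_arr a (aval e s) (aval e' s) s))"
  "wp (Coin x) f s = (f (charge 1 (set_reg x 1 s)) + f (charge 1 (set_reg x 0 s))) / 2"
  "wp (Query x a) f s = (\<integral>\<^sup>+ b. f (charge (t (calls s) (array_set n a s)) (set_reg x (of_bool b) (s\<lparr>calls := calls s + 1\<rparr>)))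
     \<partial>measure_pmf (ans (calls s) (array_set n a s)))"
  "wp (Emit a) f s = f (charge (n + 1) (s\<lparr>listed := listed s @ [array_set n a s]\<rparr>))"
  "wp (Seq P P') f s = wp P (wp P' f) s"
  "wp (Cond b P P') f s = (if bval b s then wp P f (charge 1 s) else wp P' f (charge 1 s))"
  by (auto simp: wp_def nn_integral_return_spmf nn_integral_bind_spmf o_def
      divide_ennreal_def distrib_right ennreal_divide_numeral ennreal_1 inverse_ennreal[symmetric])

lemma wp_le_ensures:
  assumes "ensures P Q s" and "\<And>s'. Q s' \<Longrightarrow> f s' \<le> v"
  shows "wp P f s \<le> v"
  using assms unfolding wp_def ensures_def by (intro nn_integral_spmf_le_const) simp

lemma ensures_mono:
  assumes "ensures P Q s" and "\<And>s'. Q s' \<Longrightarrow> Q' s'"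
  shows "ensures P Q' s"
  using assms unfolding ensures_def by blast

lemma wp_while:
  assumes "\<And>s. I s \<Longrightarrow> bval b s \<Longrightarrow> ensures P I (charge 1 s)"
    and "\<And>s. I s \<Longrightarrow> bval b s \<Longrightarrow> wp P f (charge 1 s) \<le> f s"
    and "\<And>s. I s \<Longrightarrow> \<not> bval b s \<Longrightarrow> g (charge 1 s) \<le> f s"
    and "I s"
  shows "wp (While b P) g s \<le> f s"
  unfolding wp_def exec.simps nn_integral_map_spmf o_def
  by (rule nn_integral_while_spmf_le[where I = I]) (use assms in \<open>auto simp: ensures_def wp_def\<close>)

lemma ensures_while_rank:
  assumes "\<And>s. I s \<Longrightarrow> bval b s \<Longrightarrow> ensures P I (charge 1 s)"
    and "\<And>s. I s \<Longrightarrow> bval b s \<Longrightarrow> 1 + wp P V (charge 1 s) \<le> V s"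
    and "\<And>s. I s \<Longrightarrow> \<not> bval b s \<Longrightarrow> Q (charge 1 s)"
    and "I s" and "V s < \<top>"
  shows "ensures (While b P) Q s"
  unfolding ensures_def
proof
  have *: "lossless_spmf (while_spmf (bval b) (\<lambda>s. exec n ans t P (charge 1 s)) s)"
    by (rule lossless_while_spmf[where I = I and V = V]) (use assms in \<open>auto simp: ensures_def wp_def\<close>)
  then show "lossless_spmf (exec n ans t (While b P) s)"
    by simp
  have "I s' \<and> \<not> bval b s'" if "s' \<in> set_spmf (while_spmf (bval b) (\<lambda>s. exec n ans t P (charge 1 s)) s)" for s'
    by (rule set_while_spmf[where I = I, OF _ \<open>I s\<close> that]) (use assms in \<open>auto simp: ensures_def\<close>)
  then show "\<forall>s'\<in>set_spmf (exec n ans t (While b P) s). Q s'"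
    using assms(3) by auto
qed

lemma ensures_while:
  fixes v :: "state \<Rightarrow> nat"
  assumes step: "\<And>s. I s \<Longrightarrow> bval b s \<Longrightarrow> ensures P (\<lambda>s'. I s' \<and> v s' < v s) (charge 1 s)"
    and "\<And>s. I s \<Longrightarrow> \<not> bval b s \<Longrightarrow> Q (charge 1 s)"
    and "I s"
  shows "ensures (While b P) Q s"
proof (rule ensures_while_rank[where I = I and V = "\<lambda>s. of_nat (v s)"])
  fix s assume s: "I s" "bval b s"
  show "ensures P I (charge 1 s)"
    using step[OF s] by (rule ensures_mono) simp
  show "1 + wp P (\<lambda>s. of_nat (v s)) (charge 1 s) \<le> of_nat (v s)"
  proof (cases "v s")
    \<comment> \<open>Rank 0 cannot occur inside the loop: no successor could have a smaller rank,
      yet a lossless body has a successor.\<close>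
    case 0
    have "ensures P (\<lambda>_. False) (charge 1 s)"
      using step[OF s] by (rule ensures_mono) (simp add: 0)
    then have "wp P (\<lambda>_. 1) (charge 1 s) \<le> 0"
      by (rule wp_le_ensures) simp
    moreover have "wp P (\<lambda>_. 1) (charge 1 s) = 1"
      using step[OF s] by (simp add: wp_def ensures_def lossless_spmf_def measure_spmf.emeasure_eq_measure)
    ultimately show ?thesis
      by simp
  next
    case (Suc m)
    have "wp P (\<lambda>s. of_nat (v s)) (charge 1 s) \<le> of_nat m"
      using step[OF s] by (rule wp_le_ensures) (simp add: Suc)
    then show ?thesis
      using add_left_mono[of _ _ "1::ennreal"] by (simp add: Suc)
  qed
qed (use assms in \<open>auto simp: of_nat_less_top\<close>)

end

section \<open>Uniformly random subsets\<close>

definition subset_avg :: "'a set \<Rightarrow> ('a set \<Rightarrow> real) \<Rightarrow> real" where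
  "subset_avg X a = (\<Sum>Y\<in>Pow X. a Y) / 2 ^ card X"

lemma subset_avg_empty [simp]: "subset_avg {} a = a {}"
  by (simp add: subset_avg_def)

text \<open>One fair coin decides whether \<open>x\<close> joins the subset; the loop of coin flips
  follows this recursion.\<close>

lemma subset_avg_insert:
  assumes "finite X" "x \<notin> X"
  shows "subset_avg (insert x X) a = (subset_avg X (\<lambda>Y. a (insert x Y)) + subset_avg X a) / 2"
proof -
  have "inj_on (insert x) (Pow X)"
    using assms by (auto intro!: inj_onI simp: Pow_def insert_ident)
  then have "(\<Sum>Y\<in>Pow (insert x X). a Y) = (\<Sum>Y\<in>Pow X. a Y) + (\<Sum>Y\<in>Pow X. a (insert x Y))"
    using assms by (simp add: Pow_insert, subst sum.union_disjoint) (auto simp: sum.reindex)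
  then show ?thesis
    using assms by (simp add: subset_avg_def field_simps)
qed

lemma subset_avg_nonneg: "(\<And>Y. Y \<subseteq> X \<Longrightarrow> 0 \<le> a Y) \<Longrightarrow> 0 \<le> subset_avg X a"
  unfolding subset_avg_def by (intro divide_nonneg_nonneg sum_nonneg) auto

lemma subset_avg_mono: "(\<And>Y. Y \<subseteq> X \<Longrightarrow> a Y \<le> b Y) \<Longrightarrow> subset_avg X a \<le> subset_avg X b"
  unfolding subset_avg_def by (intro divide_right_mono sum_mono) auto

lemma subset_avg_add: "subset_avg X (\<lambda>Y. a Y + b Y) = subset_avg X a + subset_avg X b"
  by (simp add: subset_avg_def sum.distrib add_divide_distrib)

lemma subset_avg_cmult: "subset_avg X (\<lambda>Y. c * a Y) = c * subset_avg X a"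
  by (simp add: subset_avg_def sum_distrib_left)

lemma subset_avg_sum: "subset_avg X (\<lambda>Y. \<Sum>i\<in>A. a i Y) = (\<Sum>i\<in>A. subset_avg X (a i))"
  unfolding subset_avg_def by (subst sum.swap) (simp add: sum_divide_distrib)

lemma subset_avg_const: "finite X \<Longrightarrow> subset_avg X (\<lambda>_. c) = c"
  by (simp add: subset_avg_def card_Pow)

text \<open>For a witness \<open>A\<close> this is the probability \<open>2 ^ -k\<close> with which
  a child keeps it.\<close>

lemma subset_avg_superset:
  assumes "finite X"
  shows "subset_avg X (\<lambda>Y. of_bool (A \<subseteq> Y)) = (if A \<subseteq> X then 1 / 2 ^ card A else 0)"
proof (cases "A \<subseteq> X")
  case True
  have "card (Pow X \<inter> {Y. A \<subseteq> Y}) = card (Pow (X - A))"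
    by (rule bij_betw_same_card[of "\<lambda>Y. Y - A"], rule bij_betwI[where g = "\<lambda>Y. Y \<union> A"]) (use True in auto)
  also have "\<dots> = 2 ^ (card X - card A)"
    using assms True by (simp add: card_Pow card_Diff_subset finite_subset)
  finally have "real (card (Pow X \<inter> {Y. A \<subseteq> Y})) = 2 ^ (card X - card A)"
    by simp
  also have "\<dots> = 2 ^ card X / 2 ^ card A"
    using card_mono[OF assms True] by (simp add: power_diff)
  finally have "real (card (Pow X \<inter> {Y. A \<subseteq> Y})) = 2 ^ card X / 2 ^ card A" .
  then show ?thesis
    using True assms by (simp add: subset_avg_def sum.If_cases of_bool_def)
next
  case False
  then have "\<And>Y. Y \<subseteq> X \<Longrightarrow> \<not> A \<subseteq> Y"
    by blast
  with False show ?thesis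
    by (simp add: subset_avg_def)
qed

section \<open>Drawing a random child and querying it\<close>

text \<open>
  Registers: 0 to 3 hold the input \<open>n\<close>, \<open>k\<close>, \<open>p\<close>, \<open>q\<close>; 4 some \<open>L\<close> with \<open>n \<le> 2 ^ L\<close>; 5 the maximal depth \<open>D\<close>;
  6 the number \<open>2 ^ k\<close> of children of a node; 7 the number of calls spent on a query;
  8 the current depth \<open>d\<close>; 9 a loop counter; 10 a coin or an answer; 11 the size of the child;
  12 the number of positive answers; 13 the power \<open>2 ^ L\<close>; 14 the number of children of the root. Array 0 holds, for each depth, how many children are still
  to be explored; array 3 holds for each element the largest depth at which it is still present on
  the current branch; array 2 is the child.
\<close>

definition split_body :: com where
  "split_body =
     Seq (Store 2 (Reg 9) (Const 0))
     (Seq (Cond (Neg (Less (Arr 3 (Reg 9)) (Reg 8)))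
             (Seq (Coin 10)
             (Seq (Store 3 (Reg 9) (Plus (Reg 8) (Reg 10)))
             (Seq (Store 2 (Reg 9) (Reg 10))
                  (Assign 11 (Plus (Reg 11) (Reg 10))))))
             Skip)
          (Assign 9 (Plus (Reg 9) (Const 1))))"

definition split_loop :: com where
  "split_loop = While (Less (Reg 9) (Reg 0)) split_body"

definition query_body :: com where
  "query_body =
     Seq (Query 10 2)
     (Seq (Assign 12 (Plus (Reg 12) (Reg 10)))
          (Assign 9 (Plus (Reg 9) (Const 1))))"

definition query_loop :: com where
  "query_loop = While (Less (Reg 9) (Reg 7)) query_body"

lemma nn_integral_bool_pmf:
  "(\<integral>\<^sup>+ b. h b \<partial>measure_pmf p) = ennreal (pmf p u) * h u + ennreal (pmf p (\<not> u)) * h (\<not> u)"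
  unfolding nn_integral_measure_pmf
  by (cases u) (simp_all add: nn_integral_count_space_finite UNIV_bool add.commute)

lemma pmf_bool_Not: "pmf p (\<not> u) = 1 - pmf p u" for p :: "bool pmf"
  using pmf_False_conv_True[of p] by (cases u) auto

lemmas state_simps = charge_def set_reg_def set_arr_def

context machine
begin

text \<open>The nested sets of a branch share one array of depths. Splitting at depth d writes d or
  d + 1, so no level up to d changes, and going back up needs no restoration.\<close>

definition level_set :: "state \<Rightarrow> nat \<Rightarrow> nat set" where
  "level_set s i = {j. j < n \<and> i \<le> arrs s 3 j}"

lemma level_set_subset: "level_set s i \<subseteq> {..<n}"
  by (auto simp: level_set_def)

lemma finite_level_set [simp]: "finite (level_set s i)"
  using level_set_subset finite_subset by blast

text \<open>Entries of array 2 from the counter on may be left over from an earlier child, hence the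
  bound by register 9.\<close>

definition chosen :: "state \<Rightarrow> nat set" where
  "chosen s = {i. i < regs s 9 \<and> arrs s 2 i \<noteq> 0}"

definition split_inv :: "state \<Rightarrow> state \<Rightarrow> bool" where
  "split_inv s0 s \<longleftrightarrow>
     regs s 9 \<le> n \<and> (\<forall>x. x \<notin> {9, 10, 11} \<longrightarrow> regs s x = regs s0 x) \<and> arrs s 0 = arrs s0 0 \<and>
     chosen s \<subseteq> level_set s0 (regs s0 8) \<and> regs s 11 = card (chosen s) \<and>
     (\<forall>i. arrs s 3 i = (if i < regs s 9 \<and> i \<in> level_set s0 (regs s0 8)
        then regs s0 8 + of_bool (i \<in> chosen s) else arrs s0 3 i)) \<and>
     listed s = listed s0 \<and> calls s = calls s0 \<and> steps s \<le> steps s0 + 8 * regs s 9"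

lemma chosen_finite [simp]: "finite (chosen s)"
  by (simp add: chosen_def)

lemma chosen_upd:
  "regs s' 9 = Suc (regs s 9) \<Longrightarrow> arrs s' 2 = (arrs s 2)(regs s 9 := v) \<Longrightarrow>
   chosen s' = (if v = 0 then chosen s else insert (regs s 9) (chosen s))"
  by (auto simp: chosen_def less_Suc_eq)

lemma chosen_notin [simp]: "regs s 9 \<notin> chosen s"
  by (simp add: chosen_def)

text \<open>The step counts 5 here and 8 in \<open>split_coin\<close> include the charge for
  entering the iteration.\<close>

definition split_skip :: "state \<Rightarrow> state" where
  "split_skip s = s\<lparr>regs := (regs s)(9 := Suc (regs s 9)), arrs := (arrs s)(2 := (arrs s 2)(regs s 9 := 0)),
     steps := steps s + 5\<rparr>"

definition split_coin :: "nat \<Rightarrow> state \<Rightarrow> state" where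
  "split_coin v s = s\<lparr>regs := (regs s)(9 := Suc (regs s 9), 10 := v, 11 := regs s 11 + v),
     arrs := (arrs s)(3 := (arrs s 3)(regs s 9 := regs s 8 + v), 2 := (arrs s 2)(regs s 9 := v)),
     steps := steps s + 8\<rparr>"

lemmas upd_order = fun_upd_twist[of "10::nat" 9] fun_upd_twist[of "11::nat" 9] fun_upd_twist[of "11::nat" 10]
  fun_upd_twist[of "3::nat" 2]

lemma split_body_eq:
  fixes Q f
  shows
  "ensures split_body Q (charge (Suc 0) s) \<longleftrightarrow>
     (if regs s 8 \<le> arrs s 3 (regs s 9) then \<forall>b. Q (split_coin (of_bool b) s) else Q (split_skip s))" (is ?E)
  "wp split_body f (charge (Suc 0) s) =
     (if regs s 8 \<le> arrs s 3 (regs s 9) then (f (split_coin 1 s) + f (split_coin 0 s)) / 2 else f (split_skip s))" (is ?W)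
proof -
  have *: "x + 5 = Suc (Suc (Suc (Suc (Suc x))))"
    "x + 8 = Suc (Suc (Suc (Suc (Suc (Suc (Suc (Suc x)))))))" for x
    by simp_all
  show "?E" "?W"
    by (cases s, simp add: split_body_def split_coin_def split_skip_def state_simps upd_order not_less *)+
qed

lemma split_inv_regs: "split_inv s0 s \<Longrightarrow> x \<notin> {9, 10, 11} \<Longrightarrow> regs s x = regs s0 x"
  by (simp add: split_inv_def)

lemma split_inv_coin:
  assumes "split_inv s0 s" "regs s 9 < n" "regs s 8 \<le> arrs s 3 (regs s 9)" "v \<le> 1"
  shows "split_inv s0 (split_coin v s)" 
    and "chosen (split_coin v s) = (if v = 0 then chosen s else insert (regs s 9) (chosen s))"
    and "regs s 9 \<in> level_set s0 (regs s0 8)"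
proof -
  show c: "chosen (split_coin v s) = (if v = 0 then chosen s else insert (regs s 9) (chosen s))"
    by (rule chosen_upd) (simp_all add: split_coin_def)
  show m: "regs s 9 \<in> level_set s0 (regs s0 8)"
    using assms by (auto simp: split_inv_def level_set_def split: if_splits)
  have v: "v = 0 \<or> v = 1"
    using assms by linarith
  show "split_inv s0 (split_coin v s)"
    unfolding split_inv_def
  proof (intro conjI allI)
    fix i
    show "arrs (split_coin v s) 3 i = (if i < regs (split_coin v s) 9 \<and> i \<in> level_set s0 (regs s0 8)
        then regs s0 8 + of_bool (i \<in> chosen (split_coin v s)) else arrs s0 3 i)"
    proof (cases "i = regs s 9")
      case True
      then show ?thesis
        using v m split_inv_regs[OF assms(1), of 8] unfolding c by (auto simp: split_coin_def)
    next
      case False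
      then show ?thesis
        using assms(1) unfolding c split_inv_def by (simp add: split_coin_def less_Suc_eq)
    qed
  qed (use assms(1,2) m v in \<open>unfold c split_inv_def, simp_all add: split_coin_def\<close>, auto)
qed

lemma split_inv_skip:
  assumes "split_inv s0 s" "regs s 9 < n" "\<not> regs s 8 \<le> arrs s 3 (regs s 9)"
  shows "split_inv s0 (split_skip s)" and "chosen (split_skip s) = chosen s"
    and "regs s 9 \<notin> level_set s0 (regs s0 8)"
proof -
  have "chosen (split_skip s) = (if (0::nat) = 0 then chosen s else insert (regs s 9) (chosen s))"
    by (rule chosen_upd) (simp_all add: split_skip_def)
  then show c: "chosen (split_skip s) = chosen s"
    by simp
  show m: "regs s 9 \<notin> level_set s0 (regs s0 8)"
    using assms by (auto simp: split_inv_def level_set_def split: if_splits)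
  show "split_inv s0 (split_skip s)"
    unfolding split_inv_def
  proof (intro conjI allI)
    fix i
    show "arrs (split_skip s) 3 i = (if i < regs (split_skip s) 9 \<and> i \<in> level_set s0 (regs s0 8)
        then regs s0 8 + of_bool (i \<in> chosen (split_skip s)) else arrs s0 3 i)"
      using assms(1) m unfolding c split_inv_def
      by (cases "i = regs s 9") (simp_all add: split_skip_def less_Suc_eq)
  qed (use assms(1,2) in \<open>unfold c split_inv_def, simp_all add: split_skip_def\<close>)
qed

lemma ensures_split_loop:
  assumes "regs s0 0 = n" "regs s0 9 = 0" "regs s0 11 = 0"
  shows "ensures split_loop (\<lambda>s. \<exists>s1. s = charge 1 s1 \<and> split_inv s0 s1 \<and> regs s1 9 = n) s0"
  unfolding split_loop_def
proof (rule ensures_while[where I = "split_inv s0" and v = "\<lambda>s. n - regs s 9"])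
  fix s assume inv: "split_inv s0 s" and b: "bval (Less (Reg 9) (Reg 0)) s"
  then have lt: "regs s 9 < n"
    using assms split_inv_regs[OF inv, of 0] by simp
  then show "ensures split_body (\<lambda>s'. split_inv s0 s' \<and> n - regs s' 9 < n - regs s 9) (charge 1 s)"
    using split_inv_coin(1)[OF inv lt] split_inv_skip(1)[OF inv lt]
    by (auto simp: split_body_eq split_coin_def split_skip_def)
next
  fix s assume inv: "split_inv s0 s" and b: "\<not> bval (Less (Reg 9) (Reg 0)) s"
  then have "regs s 9 = n"
    using assms split_inv_regs[OF inv, of 0] by (simp add: split_inv_def)
  then show "\<exists>s1. charge 1 s = charge 1 s1 \<and> split_inv s0 s1 \<and> regs s1 9 = n"
    using inv by blast
next
  show "split_inv s0 s0"
    using assms by (simp add: split_inv_def chosen_def)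
qed

lemma wp_split_loop:
  fixes a :: "nat set \<Rightarrow> real"
  assumes "regs s0 0 = n" "regs s0 9 = 0" "regs s0 11 = 0" and a: "\<And>Y. 0 \<le> a Y"
    and g: "\<And>s. split_inv s0 s \<Longrightarrow> regs s 9 = n \<Longrightarrow> g (charge 1 s) \<le> ennreal (a (chosen s))"
  shows "wp split_loop g s0 \<le> ennreal (subset_avg (level_set s0 (regs s0 8)) a)"
proof -
  let ?X = "level_set s0 (regs s0 8)"
  \<comment> \<open>The martingale averages \<open>a\<close> over all completions of the set chosen
    so far by undecided elements; each flip unfolds \<open>subset_avg_insert\<close> once.\<close>
  define f where "f s = subset_avg (?X \<inter> {regs s 9..<n}) (\<lambda>Z. a (chosen s \<union> Z))" for s
  have f_nonneg: "0 \<le> f s" for s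
    unfolding f_def by (rule subset_avg_nonneg) (rule a)
  have "wp split_loop g s0 \<le> ennreal (f s0)"
    unfolding split_loop_def
  proof (rule wp_while[where I = "split_inv s0"])
    fix s assume inv: "split_inv s0 s" and b: "bval (Less (Reg 9) (Reg 0)) s"
    then have lt: "regs s 9 < n"
      using assms split_inv_regs[OF inv, of 0] by simp
    then show "ensures split_body (split_inv s0) (charge 1 s)"
      using split_inv_coin(1)[OF inv lt] split_inv_skip(1)[OF inv lt]
      by (auto simp: split_body_eq)
    show "wp split_body (\<lambda>s. ennreal (f s)) (charge 1 s) \<le> ennreal (f s)"
    proof (cases "regs s 8 \<le> arrs s 3 (regs s 9)")
      case True
      note c = split_inv_coin[OF inv lt True]
      have "?X \<inter> {regs s 9..<n} = insert (regs s 9) (?X \<inter> {Suc (regs s 9)..<n})"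
        using c(3) lt by auto
      moreover have "f (split_coin 1 s) = subset_avg (?X \<inter> {Suc (regs s 9)..<n}) (\<lambda>Z. a (chosen s \<union> insert (regs s 9) Z))"
        and "f (split_coin 0 s) = subset_avg (?X \<inter> {Suc (regs s 9)..<n}) (\<lambda>Z. a (chosen s \<union> Z))"
        using c(2)[of 1] c(2)[of 0] by (simp_all add: f_def split_coin_def[of _ s])
      ultimately have "f s = (f (split_coin 1 s) + f (split_coin 0 s)) / 2"
        by (simp add: f_def[of s] subset_avg_insert)
      moreover have "wp split_body (\<lambda>s. ennreal (f s)) (charge 1 s) = ennreal ((f (split_coin 1 s) + f (split_coin 0 s)) / 2)"
        using True by (simp add: split_body_eq f_nonneg ennreal_divide_numeral flip: ennreal_plus)
      ultimately show ?thesis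
        by (metis order_refl)
    next
      case False
      note c = split_inv_skip[OF inv lt False]
      have "?X \<inter> {regs s 9..<n} = ?X \<inter> {Suc (regs s 9)..<n}"
        using c(3) by (intro set_eqI) (metis Int_iff atLeastLessThan_iff le_antisym not_less_eq_eq Suc_leD)
      then show ?thesis
        using c(2) False by (simp add: split_body_eq f_def) (simp add: split_skip_def)
    qed
  next
    fix s assume inv: "split_inv s0 s" and b: "\<not> bval (Less (Reg 9) (Reg 0)) s"
    then have "regs s 9 = n"
      using assms split_inv_regs[OF inv, of 0] by (simp add: split_inv_def)
    then show "g (charge 1 s) \<le> ennreal (f s)"
      using g[OF inv] by (simp add: f_def)
  next
    show "split_inv s0 s0"
      using assms by (simp add: split_inv_def chosen_def)
  qed
  moreover have "f s0 = subset_avg ?X a"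
    using assms level_set_subset[of s0 "regs s0 8"]
    by (simp add: f_def chosen_def Int_absorb2 lessThan_atLeast0[symmetric])
  ultimately show ?thesis
    by simp
qed

end

section \<open>Majority votes\<close>

context machine
begin

definition query_next :: "bool \<Rightarrow> state \<Rightarrow> state" where
  "query_next b s = s\<lparr>regs := (regs s)(9 := Suc (regs s 9), 10 := of_bool b, 12 := regs s 12 + of_bool b),
     calls := Suc (calls s), steps := steps s + t (calls s) (array_set n 2 s) + 3\<rparr>"

lemma query_body_eq:
  fixes Q f
  shows "ensures query_body Q (charge (Suc 0) s) \<longleftrightarrow>
      (\<forall>b\<in>set_pmf (ans (calls s) (array_set n 2 s)). Q (query_next b s))" (is ?E)
    and "wp query_body f (charge (Suc 0) s) =
      (\<integral>\<^sup>+ b. f (query_next b s) \<partial>measure_pmf (ans (calls s) (array_set n 2 s)))" (is ?W)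
proof -
  have *: "x + 3 = Suc (Suc (Suc x))" for x
    by simp_all
  show ?E ?W
    by (cases s, simp add: query_body_def query_next_def state_simps array_set_def
        fun_upd_twist[of "10::nat" 9] fun_upd_twist[of "12::nat" 9] fun_upd_twist[of "12::nat" 10] *)+
qed

text \<open>The last conjunct is qualitative: it is what turns \<open>verifies_candidates\<close>
  into certainty, where \<open>\<delta>\<close> would only give a small probability.\<close>

definition query_inv :: "bool \<Rightarrow> nat \<Rightarrow> state \<Rightarrow> state \<Rightarrow> bool" where
  "query_inv tb \<tau> s0 s \<longleftrightarrow>
     regs s 9 \<le> regs s0 7 \<and> regs s 12 \<le> regs s 9 \<and>
     (\<forall>x. x \<notin> {9, 10, 12} \<longrightarrow> regs s x = regs s0 x) \<and> arrs s = arrs s0 \<and> listed s = listed s0 \<and>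
     calls s = calls s0 + regs s 9 \<and> (tb \<longrightarrow> steps s \<le> steps s0 + (\<tau> + 3) * regs s 9) \<and>
     ((\<forall>i. pmf (ans i (array_set n 2 s0)) True = 0) \<longrightarrow> regs s 12 = 0)"

lemma query_inv_next:
  assumes "query_inv tb \<tau> s0 s" "regs s 9 < regs s0 7" "b \<in> set_pmf (ans (calls s) (array_set n 2 s))"
    and "\<And>i. tb \<Longrightarrow> t i (array_set n 2 s0) \<le> \<tau>"
  shows "query_inv tb \<tau> s0 (query_next b s)"
proof -
  have "array_set n 2 s = array_set n 2 s0"
    using assms(1) by (simp add: query_inv_def array_set_def)
  moreover have st: "steps s + t (calls s) (array_set n 2 s0) + 3 \<le> steps s0 + (\<tau> + 3) * Suc (regs s 9)" if tb
    using assms(1) assms(4)[OF that, of "calls s"] that by (simp add: query_inv_def algebra_simps)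
  ultimately show ?thesis
    using assms(1-3) st unfolding query_inv_def
    by (auto simp: query_next_def set_pmf_iff)
qed

lemma ensures_query_loop:
  assumes "regs s0 9 = 0" "regs s0 12 = 0"
    and "\<And>i. tb \<Longrightarrow> t i (array_set n 2 s0) \<le> \<tau>"
  shows "ensures query_loop (\<lambda>s. \<exists>s1. s = charge 1 s1 \<and> query_inv tb \<tau> s0 s1 \<and> regs s1 9 = regs s0 7) s0"
  unfolding query_loop_def
proof (rule ensures_while[where I = "query_inv tb \<tau> s0" and v = "\<lambda>s. regs s0 7 - regs s 9"])
  fix s assume inv: "query_inv tb \<tau> s0 s" and "bval (Less (Reg 9) (Reg 7)) s"
  then have lt: "regs s 9 < regs s0 7"
    by (simp add: query_inv_def)
  show "ensures query_body (\<lambda>s'. query_inv tb \<tau> s0 s' \<and> regs s0 7 - regs s' 9 < regs s0 7 - regs s 9) (charge 1 s)"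
    using query_inv_next[OF inv lt _ assms(3)] lt
    by (simp add: query_body_eq) (simp add: query_next_def diff_less_mono2)
next
  fix s assume inv: "query_inv tb \<tau> s0 s" and "\<not> bval (Less (Reg 9) (Reg 7)) s"
  then have "regs s 9 = regs s0 7"
    by (simp add: query_inv_def)
  with inv show "\<exists>s1. charge 1 s = charge 1 s1 \<and> query_inv tb \<tau> s0 s1 \<and> regs s1 9 = regs s0 7"
    by blast
qed (use assms in \<open>simp add: query_inv_def\<close>)

text \<open>The exponential moment of the number of wrong minus the number of right answers is
  contracted by each call; \<open>1 / (2 * c)\<close> is a convenient (suboptimal) base.\<close>

lemma chernoff_factor:
  fixes c e :: real
  assumes "1 / 4 \<le> c" "c < 1 / 2" "0 \<le> e" "e \<le> c"
  shows "(1 - e) * (2 * c) + e * (1 / (2 * c)) \<le> 1 - (1 - 2 * c)\<^sup>2 / 2"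
proof -
  have "2 * c * (2 * c) \<le> 1 * 1"
    using assms by (intro mult_mono) auto
  then have "2 * c \<le> 1 / (2 * c)"
    using assms by (simp add: field_simps)
  \<comment> \<open>The left side of the goal increases with \<open>e\<close>; at the worst case
    \<open>e = c\<close> it equals the right side.\<close>
  then have "e * (1 / (2 * c) - 2 * c) \<le> c * (1 / (2 * c) - 2 * c)"
    using assms by (intro mult_right_mono) auto
  also have "\<dots> = 1 / 2 - 2 * c * c"
    using assms by (simp add: field_simps)
  finally have "2 * c + e * (1 / (2 * c) - 2 * c) \<le> 2 * c + (1 / 2 - 2 * c * c)"
    by simp
  moreover have "(1 - e) * (2 * c) + e * (1 / (2 * c)) = 2 * c + e * (1 / (2 * c) - 2 * c)"
    by (simp only: algebra_simps)
  moreover have "2 * c + (1 / 2 - 2 * c * c) = 1 - (1 - 2 * c)\<^sup>2 / 2"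
    by (simp add: power2_eq_square field_simps)
  ultimately show ?thesis
    by linarith
qed

lemma wp_query_loop:
  fixes a b c :: real
  assumes s0: "regs s0 9 = 0" "regs s0 12 = 0" and c: "1 / 4 \<le> c" "c < 1 / 2"
    and err: "\<And>i. pmf (ans i (array_set n 2 s0)) (\<not> u) \<le> c"
    and "0 \<le> a" "0 \<le> b" and tb: "\<And>i. tb \<Longrightarrow> t i (array_set n 2 s0) \<le> \<tau>"
    and g: "\<And>s. query_inv tb \<tau> s0 s \<Longrightarrow> regs s 9 = regs s0 7 \<Longrightarrow>
      g (charge 1 s) \<le> ennreal (a + (if (regs s0 7 < 2 * regs s 12) = u then 0 else b))"
  shows "wp query_loop g s0 \<le> ennreal (a + (1 - (1 - 2 * c)\<^sup>2 / 2) ^ regs s0 7 * b)"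
proof -
  define \<beta> where "\<beta> = 1 - (1 - 2 * c)\<^sup>2 / 2"
  define r where "r = regs s0 7"
  define wrong where "wrong s = (if u then regs s 9 - regs s 12 else regs s 12)" for s :: state
  \<comment> \<open>Each wrong answer so far multiplies the moment by 1/(2c) and each right one by
    2c; by \<open>chernoff_factor\<close> every remaining call contributes at most a factor
    \<open>\<beta>\<close> in expectation.\<close>
  define f where "f s = a + b * (1 / (2 * c)) ^ wrong s * (2 * c) ^ (regs s 9 - wrong s) * \<beta> ^ (r - regs s 9)" for s :: state
  have "(1 - 2 * c)\<^sup>2 \<le> 1"
    using c by (intro power_le_one) auto
  then have \<beta>: "0 \<le> \<beta>"
    by (simp add: \<beta>_def)
  have f_nonneg: "0 \<le> f s" for s
    unfolding f_def using assms \<beta> by simp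
  have "wp query_loop g s0 \<le> ennreal (f s0)"
    unfolding query_loop_def
  proof (rule wp_while[where I = "query_inv tb \<tau> s0"])
    fix s assume inv: "query_inv tb \<tau> s0 s" and "bval (Less (Reg 9) (Reg 7)) s"
    then have lt: "regs s 9 < regs s0 7" and le: "regs s 12 \<le> regs s 9"
      by (simp_all add: query_inv_def)
    then show "ensures query_body (query_inv tb \<tau> s0) (charge 1 s)"
      using query_inv_next[OF inv lt _ tb] by (simp add: query_body_eq)
    define p where "p = ans (calls s) (array_set n 2 s)"
    define z where "z = b * (1 / (2 * c)) ^ wrong s * (2 * c) ^ (regs s 9 - wrong s) * \<beta> ^ (r - Suc (regs s 9))"
    have "array_set n 2 s = array_set n 2 s0"
      using inv by (simp add: query_inv_def array_set_def)
    then have e: "pmf p (\<not> u) \<le> c"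
      using err by (simp add: p_def)
    have "0 \<le> z"
      unfolding z_def using assms \<beta> by simp
    have "r - regs s 9 = Suc (r - Suc (regs s 9))"
      using lt by (simp add: r_def)
    then have fs: "f s = a + z * \<beta>"
      by (simp add: f_def z_def)
    have "wrong s \<le> regs s 9"
      using le by (simp add: wrong_def)
    moreover have "wrong (query_next u s) = wrong s" "wrong (query_next (\<not> u) s) = Suc (wrong s)"
      using le by (auto simp: wrong_def query_next_def Suc_diff_le)
    ultimately have right: "f (query_next u s) = a + z * (2 * c)" and wrong: "f (query_next (\<not> u) s) = a + z * (1 / (2 * c))"
      by (simp_all add: f_def z_def query_next_def[of _ s] Suc_diff_le)
    have "wp query_body (\<lambda>s. ennreal (f s)) (charge 1 s) = ennreal (pmf p u * f (query_next u s) + pmf p (\<not> u) * f (query_next (\<not> u) s))"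
      by (simp add: query_body_eq nn_integral_bool_pmf[of _ _ u] f_nonneg flip: p_def ennreal_mult' ennreal_plus)
    also have "pmf p u * f (query_next u s) + pmf p (\<not> u) * f (query_next (\<not> u) s) =
        a + z * ((1 - pmf p (\<not> u)) * (2 * c) + pmf p (\<not> u) * (1 / (2 * c)))"
      unfolding right wrong pmf_bool_Not[of p u] by (simp add: algebra_simps)
    also have "\<dots> \<le> a + z * \<beta>"
      using chernoff_factor[OF c _ e] \<open>0 \<le> z\<close> by (intro add_left_mono mult_left_mono) (simp_all add: \<beta>_def)
    finally show "wp query_body (\<lambda>s. ennreal (f s)) (charge 1 s) \<le> ennreal (f s)"
      by (simp add: fs ennreal_leI)
  next
    fix s assume inv: "query_inv tb \<tau> s0 s" and "\<not> bval (Less (Reg 9) (Reg 7)) s"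
    then have eq: "regs s 9 = regs s0 7" and le: "regs s 12 \<le> regs s0 7"
      by (auto simp: query_inv_def)
    have "a + (if (regs s0 7 < 2 * regs s 12) = u then 0 else b) \<le> f s"
    proof (cases "(regs s0 7 < 2 * regs s 12) = u")
      case False
      define w where "w = wrong s"
      \<comment> \<open>Ties are decided as no. A tie on a set that contains a witness is a wrong
        vote, so the inequality is not strict.\<close>
      have w: "r - w \<le> w" "w \<le> r"
        using False eq le by (auto simp: w_def wrong_def r_def)
      have "1 / (2 * c) * (2 * c) = 1"
        using c by simp
      then have "1 = (1 / (2 * c)) ^ (r - w) * (2 * c) ^ (r - w)"
        by (metis power_mult_distrib power_one)
      also have "\<dots> \<le> (1 / (2 * c)) ^ w * (2 * c) ^ (r - w)"
        using c w by (intro mult_right_mono power_increasing) (auto simp: field_simps)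
      finally have "b * 1 \<le> b * ((1 / (2 * c)) ^ w * (2 * c) ^ (r - w))"
        using assms by (intro mult_left_mono) auto
      then show ?thesis
        using False by (simp add: f_def eq w_def mult.assoc flip: r_def)
    qed (use assms \<beta> in \<open>simp add: f_def\<close>)
    then show "g (charge 1 s) \<le> ennreal (f s)"
      using g[OF inv eq] by (meson ennreal_leI order_trans)
  qed (use s0 in \<open>simp add: query_inv_def\<close>)
  moreover have "f s0 = a + \<beta> ^ r * b"
    using s0 by (simp add: f_def wrong_def)
  ultimately show ?thesis
    by (simp add: \<beta>_def r_def)
qed

end

section \<open>One iteration of the search\<close>

text \<open>Children at depth \<open>D\<close> are never expanded. An accepted one is only a
  candidate; the size test ensures that if it contains a witness, it is one.\<close>

definition decide :: com where
  "decide = Cond (Less (Reg 7) (Plus (Reg 12) (Reg 12)))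
     (Cond (Less (Plus (Reg 8) (Const 1)) (Reg 5))
        (Seq (Assign 8 (Plus (Reg 8) (Const 1))) (Store 0 (Reg 8) (Reg 6)))
        (Cond (Conj (Neg (Less (Reg 11) (Reg 1))) (Neg (Less (Reg 1) (Reg 11)))) (Emit 2) Skip))
     Skip"

definition search_body :: com where
  "search_body = Cond (Less (Const 0) (Arr 0 (Reg 8)))
     (Seq (Store 0 (Reg 8) (Minus (Arr 0 (Reg 8)) (Const 1)))
     (Seq (Assign 9 (Const 0))
     (Seq (Assign 11 (Const 0))
     (Seq split_loop
     (Seq (Assign 9 (Const 0))
     (Seq (Assign 12 (Const 0))
     (Seq query_loop
          decide)))))))
     (Assign 8 (Minus (Reg 8) (Const 1)))"

definition search_loop :: com where
  "search_loop = While (Less (Const 0) (Plus (Reg 8) (Arr 0 (Const 0)))) search_body"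

text \<open>The flag \<open>tb\<close> says that \<open>\<tau>\<close> bounds the time of a call; only the running time needs this.\<close>

locale witness_instance = machine n ans t
  for n :: nat and ans :: "nat \<Rightarrow> nat set \<Rightarrow> bool pmf" and t :: "nat \<Rightarrow> nat set \<Rightarrow> nat" +
  fixes k :: nat and Wit :: "nat set set" and c :: real and tb :: bool and \<tau> :: nat
  assumes Wit: "\<And>W. W \<in> Wit \<Longrightarrow> W \<subseteq> {..<n} \<and> card W = k"
    and err: "\<And>i X. X \<subseteq> {..<n} \<Longrightarrow> pmf (ans i X) (\<not> (\<exists>W\<in>Wit. W \<subseteq> X)) \<le> c"
    and c: "1 / 4 \<le> c" "c < 1 / 2"
    and time: "\<And>i X. tb \<Longrightarrow> X \<subseteq> {..<n} \<Longrightarrow> t i X \<le> \<tau>"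
begin

lemma finite_Wit: "finite Wit"
  by (rule finite_subset[of _ "Pow {..<n}"]) (use Wit in auto)

definition verified :: bool where
  "verified \<longleftrightarrow> (\<forall>i. \<forall>X\<subseteq>{..<n}. card X = k \<longrightarrow> X \<notin> Wit \<longrightarrow> pmf (ans i X) True = 0)"

end

locale listing = witness_instance n ans t k Wit c tb \<tau>
  for n ans t k Wit c tb \<tau> +
  fixes D r :: nat
begin

text \<open>The bound of \<open>wp_query_loop\<close> on the probability that a vote of
  \<open>r\<close> calls is wrong.\<close>

definition \<delta> :: real where
  "\<delta> = (1 - (1 - 2 * c)\<^sup>2 / 2) ^ r"

lemma \<delta>_nonneg: "0 \<le> \<delta>"
proof -
  have "(1 - 2 * c)\<^sup>2 \<le> 1"
    using c by (intro power_le_one) auto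
  then show ?thesis
    by (simp add: \<delta>_def)
qed

definition num_wit :: "nat set \<Rightarrow> nat" where
  "num_wit X = card {W\<in>Wit. W \<subseteq> X}"

definition search_inv :: "state \<Rightarrow> bool" where
  "search_inv s \<longleftrightarrow> regs s 0 = n \<and> regs s 1 = k \<and> regs s 5 = D \<and> regs s 6 = 2 ^ k \<and> regs s 7 = r \<and> regs s 8 < D"

text \<open>At most 8n for splitting, n + 1 for listing and \<open>\<tau> + 3\<close> for each of
  the \<open>r\<close> calls; the rest pays for single commands and tests.\<close>

definition max_time :: nat where
  "max_time = 9 * n + (\<tau> + 3) * r + 13"

definition pop_step :: "state \<Rightarrow> state \<Rightarrow> bool" where
  "pop_step s s' \<longleftrightarrow> search_inv s' \<and> regs s' 8 = regs s 8 - 1 \<and> arrs s' = arrs s \<and>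
     listed s' = listed s \<and> calls s' = calls s \<and> steps s' \<le> steps s + max_time"

text \<open>\<open>y\<close> is the outcome of the vote on the random child \<open>Y\<close>, not
  the truth. Everything that an iteration changes in the estimates is determined by this
  pair.\<close>

definition child_step :: "state \<Rightarrow> nat set \<Rightarrow> bool \<Rightarrow> state \<Rightarrow> bool" where
  "child_step s Y y s' \<longleftrightarrow> search_inv s' \<and>
     (\<forall>i \<le> regs s 8. level_set s' i = level_set s i) \<and>
     calls s' = calls s + r \<and> (tb \<longrightarrow> steps s' \<le> steps s + max_time) \<and>
     (if y \<and> regs s 8 + 1 < D
      then regs s' 8 = regs s 8 + 1 \<and> level_set s' (regs s 8 + 1) = Y \<and> listed s' = listed s \<and>
        arrs s' 0 = (arrs s 0)(regs s 8 := arrs s 0 (regs s 8) - 1, regs s 8 + 1 := 2 ^ k)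
      else regs s' 8 = regs s 8 \<and> listed s' = (if y \<and> card Y = k then listed s @ [Y] else listed s) \<and>
        arrs s' 0 = (arrs s 0)(regs s 8 := arrs s 0 (regs s 8) - 1))"

definition pre_split :: "state \<Rightarrow> state" where
  "pre_split s = s\<lparr>regs := (regs s)(9 := 0, 11 := 0),
     arrs := (arrs s)(0 := (arrs s 0)(regs s 8 := arrs s 0 (regs s 8) - 1)), steps := steps s + 5\<rparr>"

definition pre_query :: "state \<Rightarrow> state" where
  "pre_query s = s\<lparr>regs := (regs s)(9 := 0, 12 := 0), steps := steps s + 3\<rparr>"

lemma search_body_query:
  fixes Q f
  assumes "0 < arrs s 0 (regs s 8)"
  shows "ensures search_body Q (charge (Suc 0) s) = ensures split_loop (ensures (Seq (Assign 9 (Const 0))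
      (Seq (Assign 12 (Const 0)) (Seq query_loop decide))) Q) (pre_split s)" (is ?E)
    and "wp search_body f (charge (Suc 0) s) = wp split_loop (wp (Seq (Assign 9 (Const 0))
      (Seq (Assign 12 (Const 0)) (Seq query_loop decide))) f) (pre_split s)" (is ?W)
proof -
  have *: "x + 5 = Suc (Suc (Suc (Suc (Suc x))))" for x
    by simp_all
  show ?E ?W
    by (cases s, use assms in \<open>simp add: search_body_def pre_split_def state_simps *\<close>)+
qed

lemma after_split:
  fixes Q f
  shows "ensures (Seq (Assign 9 (Const 0)) (Seq (Assign 12 (Const 0)) (Seq query_loop decide))) Q (charge (Suc 0) s)
      = ensures query_loop (ensures decide Q) (pre_query s)" (is ?E)
    and "wp (Seq (Assign 9 (Const 0)) (Seq (Assign 12 (Const 0)) (Seq query_loop decide))) f (charge (Suc 0) s)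
      = wp query_loop (wp decide f) (pre_query s)" (is ?W)
proof -
  have *: "x + 3 = Suc (Suc (Suc x))" for x
    by simp_all
  show ?E ?W
    by (cases s, simp add: pre_query_def state_simps *)+
qed

lemma pre_split_simps [simp]:
  "level_set (pre_split s) i = level_set s i" "regs (pre_split s) 8 = regs s 8" "arrs (pre_split s) 3 = arrs s 3"
  by (simp_all add: level_set_def pre_split_def)

lemma level_set_upd [simp]:
  "level_set (s\<lparr>regs := x\<rparr>) i = level_set s i" "level_set (s\<lparr>steps := m\<rparr>) i = level_set s i"
  "level_set (s\<lparr>listed := l\<rparr>) i = level_set s i"
  by (simp_all add: level_set_def)

lemma array_set_pre_query: "regs s 9 = n \<Longrightarrow> array_set n 2 (pre_query s) = chosen s"
  by (simp add: array_set_def pre_query_def chosen_def)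

lemma split_inv_level_set:
  assumes "split_inv (pre_split s) s2" "regs s2 9 = n"
  shows "i \<le> regs s 8 \<Longrightarrow> level_set s2 i = level_set s i"
    and "level_set s2 (regs s 8 + 1) = chosen s2"
    and "chosen s2 \<subseteq> level_set s (regs s 8)"
proof -
  have arr: "arrs s2 3 j = (if j < n \<and> j \<in> level_set s (regs s 8)
        then regs s 8 + of_bool (j \<in> chosen s2) else arrs s 3 j)" for j
    using assms unfolding split_inv_def by simp
  show ch: "chosen s2 \<subseteq> level_set s (regs s 8)"
    using assms unfolding split_inv_def by simp
  show "level_set s2 i = level_set s i" if "i \<le> regs s 8"
    using that by (auto simp: level_set_def arr)
  show "level_set s2 (regs s 8 + 1) = chosen s2"
    using ch by (auto simp: level_set_def arr)
qed

lemma ensures_decide: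
  assumes s: "search_inv s" and s2: "split_inv (pre_split s) s2" "regs s2 9 = n"
    and s4: "query_inv tb \<tau> (pre_query s2) s4" "regs s4 9 = r"
  shows "ensures decide (child_step s (chosen s2) (r < 2 * regs s4 12)) (charge (Suc 0) s4)"
proof -
  have r2: "regs s2 x = regs s x" if "x \<notin> {9, 10, 11}" for x
    using s2 that by (simp add: split_inv_def pre_split_def)
  have r4: "regs s4 x = regs s2 x" if "x \<notin> {9, 10, 12}" for x
    using s4 that by (simp add: query_inv_def pre_query_def)
  have regs: "regs s4 0 = n" "regs s4 1 = k" "regs s4 5 = D" "regs s4 6 = 2 ^ k" "regs s4 7 = r"
    "regs s4 8 = regs s 8" "regs s 8 < D"
    using s by (simp_all add: r4 r2 search_inv_def)
  have size: "regs s4 11 = card (chosen s2)"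
    using s2 by (simp add: r4 split_inv_def)
  have arrs: "arrs s4 = arrs s2" "arrs s2 0 = (arrs s 0)(regs s 8 := arrs s 0 (regs s 8) - 1)"
    using s2 s4 by (simp_all add: query_inv_def pre_query_def split_inv_def pre_split_def)
  have out: "listed s4 = listed s" "calls s4 = calls s + r"
    using s2 s4 by (simp_all add: query_inv_def pre_query_def split_inv_def pre_split_def)
  have st: "tb \<longrightarrow> steps s4 + n + 5 \<le> steps s + max_time"
    using s2 s4 by (auto simp: query_inv_def pre_query_def split_inv_def pre_split_def max_time_def)
  have Y: "{j. j < n \<and> 0 < arrs s2 2 j} = chosen s2"
    using s2 by (simp add: chosen_def)
  have lev: "level_set s4 i = level_set s2 i" for i
    by (simp add: level_set_def arrs)
  note lev2 = split_inv_level_set[OF s2]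
  have lev3: "level_set (s4\<lparr>regs := x, arrs := (arrs s2)(0 := v)\<rparr>) i = level_set s2 i" for i v x
    by (simp add: level_set_def)
  show ?thesis
    using regs(7) st lev2(2)
    by (auto simp: decide_def state_simps child_step_def search_inv_def regs[unfolded One_nat_def] size array_set_def Y lev lev3 arrs out lev2(1))
qed

lemma ensures_search_body:
  assumes inv: "search_inv s"
  shows "ensures search_body (\<lambda>s'. if arrs s 0 (regs s 8) = 0 then pop_step s s' else
     \<exists>Y y. Y \<subseteq> level_set s (regs s 8) \<and> (y \<longrightarrow> (\<exists>i. pmf (ans i Y) True \<noteq> 0)) \<and> child_step s Y y s') (charge 1 s)"
proof (cases "arrs s 0 (regs s 8) = 0")
  case True
  then show ?thesis
    using inv by (simp add: search_body_def state_simps pop_step_def search_inv_def max_time_def less_imp_diff_less)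
next
  case False
  have "ensures search_body (\<lambda>s'. \<exists>Y y. Y \<subseteq> level_set s (regs s 8) \<and>
      (y \<longrightarrow> (\<exists>i. pmf (ans i Y) True \<noteq> 0)) \<and> child_step s Y y s') (charge (Suc 0) s)"
    unfolding search_body_query(1)[OF False[unfolded neq0_conv]]
  proof (rule ensures_mono[OF ensures_split_loop], goal_cases)
    case (4 s')
    then obtain s2 where s': "s' = charge (Suc 0) s2" and s2: "split_inv (pre_split s) s2" "regs s2 9 = n"
      by auto
    note ch = split_inv_level_set(3)[OF s2]
    have r: "regs (pre_query s2) 7 = r"
      using s2 inv by (simp add: pre_query_def split_inv_def pre_split_def search_inv_def)
    show ?case
      unfolding s' after_split
    proof (rule ensures_mono[OF ensures_query_loop[where tb = tb and \<tau> = \<tau>]], goal_cases)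
      case (3 i)
      then show ?case
        using time ch level_set_subset unfolding array_set_pre_query[OF s2(2)] by blast
    next
      case (4 s'')
      then obtain s4 where s'': "s'' = charge (Suc 0) s4" and s4: "query_inv tb \<tau> (pre_query s2) s4" "regs s4 9 = r"
        using r by auto
      have "\<exists>i. pmf (ans i (chosen s2)) True \<noteq> 0" if "r < 2 * regs s4 12"
        using s4(1) that unfolding query_inv_def array_set_pre_query[OF s2(2)] by auto
      then show ?case
        using ch unfolding s'' by (intro ensures_mono[OF ensures_decide[OF inv s2 s4]]) blast
    qed (simp_all add: pre_query_def)
  qed (use inv in \<open>simp_all add: pre_split_def search_inv_def\<close>)
  then show ?thesis
    using False by simp
qed

text \<open>It suffices to bound \<open>f\<close> by \<open>a Y\<close> after a correct vote and by
  \<open>a Y + b Y\<close> after a wrong one: the surcharge is weighted by \<open>\<delta>\<close>,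
  and only an average over subsets remains.\<close>

lemma wp_search_body:
  fixes a b :: "nat set \<Rightarrow> real"
  assumes inv: "search_inv s" and pos: "0 < arrs s 0 (regs s 8)"
    and ab: "\<And>Y. 0 \<le> a Y" "\<And>Y. 0 \<le> b Y"
    and f: "\<And>Y y s'. Y \<subseteq> level_set s (regs s 8) \<Longrightarrow> child_step s Y y s' \<Longrightarrow>
      f s' \<le> ennreal (a Y + (if y = (\<exists>W\<in>Wit. W \<subseteq> Y) then 0 else b Y))"
  shows "wp search_body f (charge 1 s) \<le> ennreal (subset_avg (level_set s (regs s 8)) (\<lambda>Y. a Y + \<delta> * b Y))"
proof -
  have "wp search_body f (charge (Suc 0) s) \<le>
      ennreal (subset_avg (level_set (pre_split s) (regs (pre_split s) 8)) (\<lambda>Y. a Y + \<delta> * b Y))"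
    unfolding search_body_query(2)[OF pos]
  proof (rule wp_split_loop, goal_cases)
    case (5 s2)
    note s2 = 5
    note ch = split_inv_level_set(3)[OF s2]
    have r: "regs (pre_query s2) 7 = r"
      using s2 inv by (simp add: pre_query_def split_inv_def pre_split_def search_inv_def)
    have "wp query_loop (wp decide f) (pre_query s2) \<le>
        ennreal (a (chosen s2) + (1 - (1 - 2 * c)\<^sup>2 / 2) ^ regs (pre_query s2) 7 * b (chosen s2))"
    proof (rule wp_query_loop[where u = "\<exists>W\<in>Wit. W \<subseteq> chosen s2" and tb = tb and \<tau> = \<tau>, OF _ _ c], goal_cases)
      case (3 i)
      then show ?case
        unfolding array_set_pre_query[OF s2(2)] using ch level_set_subset by (intro err) blast
    next
      case (6 i)
      then show ?case
        using time ch level_set_subset unfolding array_set_pre_query[OF s2(2)] by blast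
    next
      case (7 s4)
      then have s4: "query_inv tb \<tau> (pre_query s2) s4" "regs s4 9 = r"
        by (simp_all add: r)
      show ?case
        using wp_le_ensures[OF ensures_decide[OF inv s2 s4] f[OF ch]] by (simp add: r)
    qed (simp_all add: pre_query_def ab)
    then show ?case
      unfolding One_nat_def after_split by (simp add: r \<delta>_def)
  qed (use inv ab \<delta>_nonneg in \<open>simp_all add: pre_split_def search_inv_def\<close>)
  then show ?thesis
    by (simp add: pre_split_def[of s] level_set_def)
qed

end

section \<open>Expected cost of the search\<close>

text \<open>The survival recursion of the critical process. With success probability x/B each, B
  independent tries all fail with probability at most 1/(1 + x), by Bernoulli's inequality and (1 -
  y)(1 + y) \<le> 1. For x = 1/j this is 1 - 1/(j + 1), and a loss \<open>e\<close> is passed on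
  without growing.\<close>

lemma one_minus_div_power_le:
  fixes x e :: real
  assumes "0 < B" "1 \<le> j" "0 \<le> e" "x = max 0 (1 / real j - e)"
  shows "(1 - x / real B) ^ B \<le> 1 - max 0 (1 / (real j + 1) - e)"
proof -
  have "1 / real j \<le> 1"
    using assms by simp
  then have "1 / real j - e \<le> 1"
    using assms by linarith
  then have x: "0 \<le> x" "x \<le> 1"
    using assms by simp_all
  have x_B: "x / real B \<le> 1"
    using assms x by (simp add: divide_le_eq)
  have "- 1 \<le> x / real B"
    using x(1) by (rule_tac order_trans[of _ 0]) simp_all
  then have "1 + x \<le> (1 + x / real B) ^ B"
    using Bernoulli_inequality[of "x / real B" B] \<open>0 < B\<close> by simp
  then have "(1 - x / real B) ^ B * (1 + x) \<le> (1 - x / real B) ^ B * (1 + x / real B) ^ B"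
    using x_B by (intro mult_left_mono) auto
  also have "\<dots> = ((1 - x / real B) * (1 + x / real B)) ^ B"
    by (simp add: power_mult_distrib)
  also have "\<dots> \<le> 1"
    using x x_B by (intro power_le_one mult_nonneg_nonneg) (auto simp: algebra_simps)
  finally have "(1 - x / real B) ^ B \<le> 1 / (1 + x)"
    using x by (simp add: field_simps)
  also have "\<dots> = 1 - x / (1 + x)"
    using x by (simp add: field_simps)
  also have "\<dots> \<le> 1 - max 0 (1 / (real j + 1) - e)"
  proof -
    have "1 / (real j + 1) - e \<le> x / (1 + x)"
    proof (cases "0 \<le> 1 / real j - e")
      case True
      then have x_eq: "x = 1 / real j - e"
        using assms by simp
      have "1 / (real j + 1) - e \<le> 1 / (real j + 1) - e * (real j / (real j + 1))"
        using assms by (intro diff_left_mono mult_left_le) auto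
      also have "\<dots> = x / (1 + 1 / real j)"
      proof -
        have "0 < real j" "0 < real j + 1" "0 < 1 + 1 / real j"
          using assms(2) by (auto intro: add_pos_nonneg)
        then show ?thesis
          unfolding x_eq by (simp add: divide_simps add.commute)
      qed
      also have "\<dots> \<le> x / (1 + x)"
        using x x_eq assms by (intro divide_left_mono) (auto intro!: mult_pos_pos add_pos_nonneg)
      finally show ?thesis .
    next
      case False
      have "1 / (real j + 1) \<le> 1 / real j"
        using assms by (simp add: field_simps)
      then have "1 / (real j + 1) - e \<le> 0"
        using False by linarith
      also have "0 \<le> x / (1 + x)"
        using x by simp
      finally show ?thesis .
    qed
    then show ?thesis
      using x by simp
  qed
  finally show ?thesis .
qed

text \<open>Linearity over the surplus elements: given that \<open>W\<close> survives, each of them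
  survives with probability 1/2. This halving explains the power of two in
  \<open>loss\<close>.\<close>

lemma subset_avg_superset_card:
  assumes "finite X" "W \<subseteq> X"
  shows "subset_avg X (\<lambda>Y. of_bool (W \<subseteq> Y) * real (card (Y - W))) = real (card (X - W)) / 2 ^ Suc (card W)"
proof -
  have "finite W"
    using assms finite_subset by blast
  have "subset_avg X (\<lambda>Y. of_bool (W \<subseteq> Y) * real (card (Y - W))) =
      subset_avg X (\<lambda>Y. \<Sum>x\<in>X - W. of_bool (insert x W \<subseteq> Y))"
    unfolding subset_avg_def
  proof (intro arg_cong2[where f = "(/)"] sum.cong refl)
    fix Y assume "Y \<in> Pow X"
    then have "Y - W = (X - W) \<inter> {x. x \<in> Y}"
      by auto
    then have "real (card (Y - W)) = (\<Sum>x\<in>X - W. of_bool (x \<in> Y))"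
      using assms by simp
    then show "of_bool (W \<subseteq> Y) * real (card (Y - W)) = (\<Sum>x\<in>X - W. of_bool (insert x W \<subseteq> Y))"
      by (cases "W \<subseteq> Y") auto
  qed
  also have "\<dots> = (\<Sum>x\<in>X - W. 1 / 2 ^ Suc (card W))"
    unfolding subset_avg_sum
  proof (intro sum.cong refl)
    fix x assume "x \<in> X - W"
    then have "insert x W \<subseteq> X" "card (insert x W) = Suc (card W)"
      using assms \<open>finite W\<close> by auto
    then show "subset_avg X (\<lambda>Y. of_bool (insert x W \<subseteq> Y)) = 1 / 2 ^ Suc (card W)"
      using subset_avg_superset[OF assms(1), of "insert x W"] by simp
  qed
  finally show ?thesis
    by simp
qed

context listing
begin

lemma num_wit_eq_0_iff: "num_wit X = 0 \<longleftrightarrow> \<not> (\<exists>W\<in>Wit. W \<subseteq> X)"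
  using finite_Wit by (auto simp: num_wit_def)

lemma subset_avg_num_wit: "finite X \<Longrightarrow> subset_avg X (\<lambda>Y. real (num_wit Y)) = real (num_wit X) / 2 ^ k"
proof -
  assume "finite X"
  have *: "real (num_wit Y) = (\<Sum>W\<in>Wit. of_bool (W \<subseteq> Y))" for Y
    using finite_Wit by (simp add: num_wit_def Int_def)
  have "subset_avg X (\<lambda>Y. real (num_wit Y)) = (\<Sum>W\<in>Wit. of_bool (W \<subseteq> X) / 2 ^ k)"
    unfolding * subset_avg_sum using Wit subset_avg_superset[OF \<open>finite X\<close>]
    by (intro sum.cong) auto
  then show ?thesis
    by (simp add: * sum_divide_distrib)
qed

text \<open>Bounds the expected number of iterations caused by one unexplored child at depth
  \<open>i\<close>. Per level and witness, the 3 covers the constant 2 of the new children and the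
  step back up. Of the final 2, one unit pays for the iteration itself and one for expanding wrongly
  accepted children.\<close>

definition weight :: "state \<Rightarrow> nat \<Rightarrow> real" where
  "weight s i = 3 * real (D - i) * real (num_wit (level_set s i)) + 2"

text \<open>The last summand counts the steps back up that are still due.\<close>

definition potential :: "state \<Rightarrow> real" where
  "potential s = (\<Sum>i\<le>regs s 8. real (arrs s 0 i) * weight s i) + real (regs s 8)"

lemma weight_ge: "2 \<le> weight s i"
  by (simp add: weight_def)

lemma potential_nonneg: "0 \<le> potential s"
  unfolding potential_def
  by (intro add_nonneg_nonneg sum_nonneg mult_nonneg_nonneg order_trans[OF _ weight_ge]) auto

lemma potential_ge_weight:
  assumes "0 < arrs s 0 (regs s 8)"
  shows "weight s (regs s 8) \<le> potential s"
proof -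
  have "1 * weight s (regs s 8) \<le> real (arrs s 0 (regs s 8)) * weight s (regs s 8)"
    using assms weight_ge[of s "regs s 8"] by (intro mult_right_mono) auto
  also have "\<dots> \<le> (\<Sum>i\<le>regs s 8. real (arrs s 0 i) * weight s i)"
    by (intro member_le_sum mult_nonneg_nonneg order_trans[OF _ weight_ge]) auto
  finally show ?thesis
    by (simp add: potential_def)
qed

lemma potential_pop:
  assumes "pop_step s s'" "arrs s 0 (regs s 8) = 0" "0 < regs s 8"
  shows "potential s' = potential s - 1"
proof -
  have [simp]: "weight s' i = weight s i" for i
    using assms by (simp add: weight_def level_set_def pop_step_def)
  obtain d where d: "regs s 8 = Suc d"
    using assms by (cases "regs s 8") auto
  then have "regs s' 8 = d" "arrs s' = arrs s"
    using assms by (simp_all add: pop_step_def)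
  then show ?thesis
    using assms(2) by (simp add: potential_def d)
qed

lemma potential_child:
  assumes "child_step s Y y s'" "0 < arrs s 0 (regs s 8)"
  shows "potential s' = potential s - weight s (regs s 8) +
    (if y \<and> regs s 8 + 1 < D then 2 ^ k * (3 * real (D - regs s 8 - 1) * real (num_wit Y) + 2) + 1 else 0)"
proof -
  define d where "d = regs s 8"
  have w: "weight s' i = weight s i" if "i \<le> d" for i
    using assms that by (simp add: weight_def child_step_def d_def)
  have lt: "arrs s' 0 i = arrs s 0 i" if "i < d" for i
    using assms that by (auto simp: child_step_def d_def split: if_splits)
  have eq: "real (arrs s' 0 d) = real (arrs s 0 d) - 1"
    using assms by (auto simp: child_step_def d_def split: if_splits)
  have split: "(\<Sum>i\<le>d. h i) = (\<Sum>i<d. h i) + h d" for h :: "nat \<Rightarrow> real"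
    by (metis lessThan_Suc_atMost sum.lessThan_Suc)
  have "(\<Sum>i\<le>d. real (arrs s' 0 i) * weight s' i) = (\<Sum>i\<le>d. real (arrs s 0 i) * weight s i) - weight s d"
    by (simp add: split w lt eq algebra_simps)
  then show ?thesis
    using assms(1) by (auto simp: potential_def child_step_def weight_def simp flip: d_def split: if_splits)
qed

text \<open>Used four times: for termination with \<open>K = 1\<close>, for calls with
  \<open>K = r\<close>, for time with \<open>K = max_time\<close>, and for false positives with
  \<open>K = \<delta>\<close> and \<open>E = 1\<close>. \<open>E\<close> is the extra price of a
  wrong vote.\<close>

lemma wp_search_body_cost:
  fixes A K E :: real
  assumes small: "4 * 2 ^ k * \<delta> \<le> 1"
    and inv: "search_inv s" and guard: "0 < regs s 8 + arrs s 0 0"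
    and nonneg: "0 \<le> A" "0 \<le> K" "0 \<le> E"
    and pop: "\<And>s'. pop_step s s' \<Longrightarrow> f s' \<le> ennreal (A + K * potential s')"
    and child: "\<And>Y y s'. Y \<subseteq> level_set s (regs s 8) \<Longrightarrow> child_step s Y y s' \<Longrightarrow>
      f s' \<le> ennreal (A + K * potential s' + (if y = (\<exists>W\<in>Wit. W \<subseteq> Y) then 0 else E))"
  shows "wp search_body f (charge 1 s) \<le> ennreal (A + K * (potential s - 1) + \<delta> * E)"
proof (cases "arrs s 0 (regs s 8) = 0")
  case True
  then have "0 < regs s 8"
    using guard by (cases "regs s 8") auto
  have "wp search_body f (charge 1 s) \<le> ennreal (A + K * (potential s - 1))"
    using ensures_search_body[OF inv] unfolding if_P[OF True]
    by (rule wp_le_ensures) (metis pop potential_pop True \<open>0 < regs s 8\<close>)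
  also have "\<dots> \<le> ennreal (A + K * (potential s - 1) + \<delta> * E)"
    using \<delta>_nonneg nonneg by (intro ennreal_leI) simp
  finally show ?thesis .
next
  case False
  then have pos: "0 < arrs s 0 (regs s 8)"
    by simp
  define d where "d = regs s 8"
  define X where "X = level_set s d"
  define w where "w = weight s d"
  define j where "j = real (D - d)"
  have "d < D"
    using inv by (simp add: search_inv_def d_def)
  then have j: "1 \<le> j" "real (D - d - 1) = j - 1"
    by (simp_all add: j_def of_nat_diff)
  have w: "w \<le> potential s"
    using potential_ge_weight[OF pos] by (simp add: w_def d_def)
  define a where "a Y = A + K * (potential s - w) + K * ((2 ^ k * (3 * j - 1) + 1) * real (num_wit Y))" for Y
  \<comment> \<open>A wrongly accepted child contains no witness, so it adds at most
    \<open>2 ^ k\<close> children of weight 2 and one step back up.\<close>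
  define b where "b Y = E + K * (2 * 2 ^ k + 1)" for Y :: "nat set"
  have "wp search_body f (charge 1 s) \<le> ennreal (subset_avg (level_set s (regs s 8)) (\<lambda>Y. a Y + \<delta> * b Y))"
  proof (rule wp_search_body[OF inv pos])
    show "0 \<le> a Y" for Y
      unfolding a_def using nonneg w j by (intro add_nonneg_nonneg mult_nonneg_nonneg) auto
    show "0 \<le> b Y" for Y
      unfolding b_def using nonneg by simp
    fix Y y s' assume Y: "Y \<subseteq> level_set s (regs s 8)" and step: "child_step s Y y s'"
    define truth where "truth \<longleftrightarrow> (\<exists>W\<in>Wit. W \<subseteq> Y)"
    define m where "m = real (num_wit Y)"
    have pot: "potential s' = potential s - w + (if y \<and> d + 1 < D then 2 ^ k * (3 * (j - 1) * m + 2) + 1 else 0)"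
      using potential_child[OF step pos] j(2) by (simp add: w_def d_def m_def)
    have "A + K * potential s' + (if y = truth then 0 else E) \<le> a Y + (if y = truth then 0 else b Y)"
    proof (cases truth)
      case True
      then have "1 \<le> m"
        using num_wit_eq_0_iff[of Y] by (simp add: truth_def m_def Suc_le_eq)
      \<comment> \<open>Since \<open>m\<close> is at least 1, the constants can be multiplied by
        \<open>m\<close>; the bound becomes linear in the number of witnesses and can be
        averaged.\<close>
      then have "2 ^ k * (3 * (j - 1) * m + 2) + 1 \<le> 2 ^ k * (3 * (j - 1) * m + 2 * m) + m"
        by (intro add_mono mult_left_mono[of _ _ "2 ^ k"]) auto
      also have "\<dots> = (2 ^ k * (3 * j - 1) + 1) * m"
        by (simp add: algebra_simps)
      finally have *: "2 ^ k * (3 * (j - 1) * m + 2) + 1 \<le> (2 ^ k * (3 * j - 1) + 1) * m" .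
      moreover have "0 \<le> (2 ^ k * (3 * j - 1) + 1) * m"
        using j \<open>1 \<le> m\<close> by (intro mult_nonneg_nonneg) auto
      ultimately have "potential s' \<le> potential s - w + (2 ^ k * (3 * j - 1) + 1) * m"
        unfolding pot by simp
      then have "A + K * potential s' \<le> a Y"
        using mult_left_mono[OF _ nonneg(2)] unfolding a_def m_def by (fastforce simp: algebra_simps)
      moreover have "E \<le> b Y"
        unfolding b_def using nonneg by simp
      ultimately show ?thesis
        by auto
    next
      case False
      then have m: "m = 0"
        using num_wit_eq_0_iff[of Y] by (simp add: truth_def m_def)
      show ?thesis
        using nonneg False unfolding pot a_def b_def m m_def[symmetric]
        by (auto simp: algebra_simps)
    qed
    then show "f s' \<le> ennreal (a Y + (if y = (\<exists>W\<in>Wit. W \<subseteq> Y) then 0 else b Y))"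
      using child[OF Y step] unfolding truth_def by (meson ennreal_leI order_trans)
  qed
  also have "subset_avg (level_set s (regs s 8)) (\<lambda>Y. a Y + \<delta> * b Y) =
      A + K * (potential s - w) + K * ((2 ^ k * (3 * j - 1) + 1) * (real (num_wit X) / 2 ^ k)) + \<delta> * (E + K * (2 * 2 ^ k + 1))"
    unfolding a_def b_def subset_avg_add
    by (simp add: subset_avg_const subset_avg_cmult subset_avg_num_wit X_def d_def)
  also have "\<dots> \<le> A + K * (potential s - 1) + \<delta> * E"
  proof -
    have "(2 ^ k * (3 * j - 1) + 1) * (real (num_wit X) / 2 ^ k) = (3 * j - 1 + 1 / 2 ^ k) * real (num_wit X)"
      by (simp add: field_simps)
    also have "\<dots> \<le> 3 * j * real (num_wit X)"
      by (intro mult_right_mono) auto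
    also have "\<dots> = w - 2"
      by (simp add: w_def weight_def j_def X_def)
    finally have "(2 ^ k * (3 * j - 1) + 1) * (real (num_wit X) / 2 ^ k) \<le> w - 2" .
    moreover have "(1::real) \<le> 2 ^ k"
      by simp
    then have "\<delta> * (2 * 2 ^ k + 1) \<le> \<delta> * (4 * 2 ^ k)"
      using \<delta>_nonneg by (intro mult_left_mono) linarith+
    then have "\<delta> * (2 * 2 ^ k + 1) \<le> 4 * 2 ^ k * \<delta>"
      by (simp only: mult.commute)
    ultimately have "potential s - w + (2 ^ k * (3 * j - 1) + 1) * (real (num_wit X) / 2 ^ k) + \<delta> * (2 * 2 ^ k + 1) \<le> potential s - 1"
      using small by linarith
    from mult_left_mono[OF this nonneg(2)] show ?thesis
      by (simp add: algebra_simps)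
  qed
  finally show ?thesis
    by (simp add: ennreal_leI)
qed

end

section \<open>Probability of missing a witness\<close>

context listing
begin

text \<open>A union bound: each surplus element survives the remaining \<open>D - i\<close> halvings
  with probability \<open>2 ^ -(D - i)\<close>, and each remaining generation needs one correct vote
  on the way to \<open>W\<close>.\<close>

definition loss :: "nat set \<Rightarrow> nat \<Rightarrow> nat set \<Rightarrow> real" where
  "loss W i X = real (card (X - W)) / 2 ^ (D - i) + real (D - i) * \<delta>"

text \<open>Without errors and without surplus elements, the branching process of the nodes that contain
  \<open>W\<close> is critical, so it survives \<open>j\<close> generations with probability at least \<open>1 / (j + 1)\<close>. Hence a
  child of a node at depth \<open>D - j\<close> that contains \<open>W\<close> leads to \<open>W\<close> with probability at least
  \<open>1 / j\<close>. Errors and surplus elements are charged additively to \<open>loss\<close>.\<close>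

definition chance :: "nat set \<Rightarrow> nat \<Rightarrow> nat set \<Rightarrow> real" where
  "chance W i X = max 0 (1 / real (D - i) - loss W i X)"

text \<open>Bounds the probability that all unexplored children at depth \<open>i\<close> fail to
  lead to \<open>W\<close>, as if they were independent; dividing by \<open>2 ^ k\<close> accounts
  for a child losing \<open>W\<close>.\<close>

definition miss_factor :: "nat set \<Rightarrow> state \<Rightarrow> nat \<Rightarrow> real" where
  "miss_factor W s i = (if W \<subseteq> level_set s i then (1 - chance W i (level_set s i) / 2 ^ k) ^ arrs s 0 i else 1)"

definition miss :: "nat set \<Rightarrow> state \<Rightarrow> real" where
  "miss W s = (if W \<in> set (listed s) then 0 else \<Prod>i\<le>regs s 8. miss_factor W s i)"

lemma loss_nonneg: "0 \<le> loss W i X"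
  unfolding loss_def using \<delta>_nonneg by simp

lemma chance_bounds: "0 \<le> chance W i X" "chance W i X / 2 ^ k \<le> 1"
proof -
  show "0 \<le> chance W i X"
    by (simp add: chance_def)
  have "1 / real (D - i) \<le> 1"
    by (cases "D - i") auto
  then have "chance W i X \<le> 1"
    using loss_nonneg[of W i X] by (simp add: chance_def)
  then show "chance W i X / 2 ^ k \<le> 1"
    by (simp add: divide_le_eq order_trans[OF _ one_le_power[of 2 k]])
qed

lemma miss_factor_nonneg: "0 \<le> miss_factor W s i"
  using chance_bounds[of W i "level_set s i"] by (simp add: miss_factor_def)

lemma miss_pop:
  assumes "pop_step s s'" "arrs s 0 (regs s 8) = 0" "0 < regs s 8"
  shows "miss W s' = miss W s"
proof -
  have [simp]: "miss_factor W s' i = miss_factor W s i" for i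
    using assms by (simp add: miss_factor_def level_set_def pop_step_def)
  obtain d where d: "regs s 8 = Suc d"
    using assms by (cases "regs s 8") auto
  then have "regs s' 8 = d" "listed s' = listed s"
    using assms by (simp_all add: pop_step_def)
  moreover have "miss_factor W s (Suc d) = 1"
    using assms(2) by (simp add: miss_factor_def d)
  ultimately show ?thesis
    by (simp add: miss_def d)
qed

text \<open>The survival bound of a node at depth \<open>i\<close> itself, whereas
  \<open>chance\<close> concerns one of its children that contains \<open>W\<close>;
  \<open>one_minus_div_power_le\<close> links the two.\<close>

definition child_chance :: "nat set \<Rightarrow> nat \<Rightarrow> nat set \<Rightarrow> real" where
  "child_chance W i Y = max 0 (1 / (real (D - i) + 1) - loss W i Y)"

lemma child_chance_bounds: "0 \<le> child_chance W i Y" "child_chance W i Y \<le> 1"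
  using loss_nonneg[of W i Y] by (auto simp: child_chance_def intro: order_trans[of _ "1 / (real (D - i) + 1)"])

text \<open>\<open>R\<close> collects the factors that the new child does not touch: those of the
  shallower levels and of its unexplored siblings.\<close>

lemma miss_child:
  assumes W: "W \<in> Wit" and inv: "search_inv s" and new: "W \<notin> set (listed s)"
    and step: "child_step s Y y s'" and pos: "0 < arrs s 0 (regs s 8)" and Y: "Y \<subseteq> level_set s (regs s 8)"
  defines "R \<equiv> (\<Prod>i<regs s 8. miss_factor W s i) * (if W \<subseteq> level_set s (regs s 8)
      then (1 - chance W (regs s 8) (level_set s (regs s 8)) / 2 ^ k) ^ (arrs s 0 (regs s 8) - 1) else 1)"
  shows "miss W s' \<le> R * (if y \<and> W \<subseteq> Y then 1 - child_chance W (regs s 8 + 1) Y else 1)"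
proof -
  define d where "d = regs s 8"
  have "0 \<le> R"
    unfolding R_def using chance_bounds by (auto intro!: mult_nonneg_nonneg prod_nonneg miss_factor_nonneg)
  have lev: "level_set s' i = level_set s i" if "i \<le> d" for i
    using step that by (simp add: child_step_def d_def)
  have cnt: "arrs s' 0 i = (if i = d then arrs s 0 d - 1 else arrs s 0 i)" if "i \<le> d" for i
    using step that by (auto simp: child_step_def d_def split: if_splits)
  have "(\<Prod>i\<le>d. miss_factor W s' i) = (\<Prod>i<d. miss_factor W s' i) * miss_factor W s' d"
    by (metis lessThan_Suc_atMost prod.lessThan_Suc)
  also have "\<dots> = R"
  proof -
    have "(\<Prod>i<d. miss_factor W s' i) = (\<Prod>i<d. miss_factor W s i)"
      by (intro prod.cong) (auto simp: miss_factor_def lev cnt)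
    then show ?thesis
      unfolding R_def d_def[symmetric] by (simp add: miss_factor_def[of _ s'] lev cnt)
  qed
  finally have prod: "(\<Prod>i\<le>d. miss_factor W s' i) = R" .
  have "d < D"
    using inv by (simp add: search_inv_def d_def)
  show ?thesis
  proof (cases "y \<and> d + 1 < D")
    case True
    then have s': "regs s' 8 = Suc d" "listed s' = listed s" "level_set s' (Suc d) = Y" "arrs s' 0 (Suc d) = 2 ^ k"
      using step by (simp_all add: child_step_def d_def)
    then have eq: "miss W s' = R * (if W \<subseteq> Y then (1 - chance W (Suc d) Y / 2 ^ k) ^ (2 ^ k) else 1)"
      using new prod by (simp add: miss_def) (simp add: miss_factor_def)
    have "(1 - chance W (Suc d) Y / real (2 ^ k)) ^ (2 ^ k) \<le> 1 - max 0 (1 / (real (D - Suc d) + 1) - loss W (Suc d) Y)"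
      by (rule one_minus_div_power_le) (use True loss_nonneg in \<open>auto simp: chance_def\<close>)
    then have "(1 - chance W (Suc d) Y / 2 ^ k) ^ (2 ^ k) \<le> 1 - child_chance W (Suc d) Y"
      by (simp add: child_chance_def)
    then show ?thesis
      unfolding eq using \<open>0 \<le> R\<close> True by (auto simp flip: d_def intro: mult_left_mono)
  next
    case False
    then have s': "regs s' 8 = d" "listed s' = (if y \<and> card Y = k then listed s @ [Y] else listed s)"
      using step by (simp_all add: child_step_def d_def split: if_splits)
    have le: "miss W s' \<le> R"
      using prod \<open>0 \<le> R\<close> by (simp add: miss_def s')
    show ?thesis
    proof (cases "y \<and> W \<subseteq> Y")
      case y: True
      then have D: "D - Suc d = 0" "Suc d = D"
        using False \<open>d < D\<close> by auto
      have "finite Y"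
        using Y finite_subset finite_level_set by blast
      show ?thesis
      proof (cases "Y = W")
        case True
        then have "miss W s' = 0"
          using y W Wit s' by (simp add: miss_def)
        then show ?thesis
          using \<open>0 \<le> R\<close> child_chance_bounds by simp
      next
        case False
        then have "Y - W \<noteq> {}"
          using y by blast
        then have "1 \<le> card (Y - W)"
          using \<open>finite Y\<close> by (simp add: Suc_le_eq card_gt_0_iff)
        \<comment> \<open>At depth \<open>D\<close> the surplus is divided by \<open>2 ^ 0\<close>,
          so a single surplus element makes the loss at least 1.\<close>
        then have "child_chance W (Suc d) Y = 0"
          using D by (simp add: child_chance_def loss_def)
        then show ?thesis
          using le by (simp flip: d_def)
      qed
    qed (use le in auto)
  qed
qed

lemma wp_search_body_miss:
  assumes small: "4 * 2 ^ k * \<delta> \<le> 1" and W: "W \<in> Wit"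
    and inv: "search_inv s" and guard: "0 < regs s 8 + arrs s 0 0"
  shows "wp search_body (\<lambda>s'. ennreal (miss W s')) (charge 1 s) \<le> ennreal (miss W s)"
proof (cases "arrs s 0 (regs s 8) = 0")
  case True
  then have "0 < regs s 8"
    using guard by (cases "regs s 8") auto
  show ?thesis
    using ensures_search_body[OF inv] unfolding if_P[OF True]
    by (rule wp_le_ensures) (metis miss_pop True \<open>0 < regs s 8\<close> order_refl)
next
  case False
  then have pos: "0 < arrs s 0 (regs s 8)"
    by simp
  show ?thesis
  proof (cases "W \<in> set (listed s)")
    case True
    show ?thesis
      using ensures_search_body[OF inv] unfolding if_not_P[OF False]
    proof (rule wp_le_ensures)
      fix s' assume "\<exists>Y y. Y \<subseteq> level_set s (regs s 8) \<and> (y \<longrightarrow> (\<exists>i. pmf (ans i Y) True \<noteq> 0)) \<and> child_step s Y y s'"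
      then have "W \<in> set (listed s')"
        using True by (auto simp: child_step_def split: if_splits)
      then show "ennreal (miss W s') \<le> ennreal (miss W s)"
        by (simp add: miss_def)
    qed
  next
    case new: False
    define d where "d = regs s 8"
    define X where "X = level_set s d"
    define R where "R = (\<Prod>i<d. miss_factor W s i) * (if W \<subseteq> X then (1 - chance W d X / 2 ^ k) ^ (arrs s 0 d - 1) else 1)"
    define j where "j = D - d"
    have "d < D"
      using inv by (simp add: search_inv_def d_def)
    then have j: "1 \<le> j" "D - (d + 1) = j - 1"
      by (auto simp: j_def)
    have R: "0 \<le> R"
      unfolding R_def using chance_bounds by (auto intro!: mult_nonneg_nonneg prod_nonneg miss_factor_nonneg)
    have miss_s: "miss W s = R * (if W \<subseteq> X then 1 - chance W d X / 2 ^ k else 1)"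
    proof -
      have "(\<Prod>i\<le>d. miss_factor W s i) = (\<Prod>i<d. miss_factor W s i) * miss_factor W s d"
        by (metis lessThan_Suc_atMost prod.lessThan_Suc)
      moreover obtain m where "arrs s 0 d = Suc m"
        using pos by (cases "arrs s 0 d") (auto simp: d_def)
      ultimately show ?thesis
        using new by (simp add: miss_def R_def miss_factor_def X_def flip: d_def)
    qed
    have \<delta>1: "\<delta> \<le> 1"
    proof -
      have "1 * \<delta> \<le> 4 * 2 ^ k * \<delta>"
        using \<delta>_nonneg one_le_power[of "2::real" k] by (intro mult_right_mono) (linarith, simp)
      then show ?thesis
        using small by linarith
    qed
    \<comment> \<open>A correct vote leaves the miss bound \<open>R * (1 - G Y)\<close>; a wrong one
      may forfeit the whole chance, hence the surcharge \<open>R * G Y\<close>.\<close>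
    define G where "G Y = of_bool (W \<subseteq> Y) * child_chance W (d + 1) Y" for Y
    have G: "0 \<le> G Y" "G Y \<le> 1" for Y
      using child_chance_bounds by (auto simp: G_def)
    have "wp search_body (\<lambda>s'. ennreal (miss W s')) (charge 1 s) \<le>
        ennreal (subset_avg (level_set s (regs s 8)) (\<lambda>Y. R * (1 - G Y) + \<delta> * (R * G Y)))"
    proof (rule wp_search_body[OF inv pos])
      show "0 \<le> R * (1 - G Y)" "0 \<le> R * G Y" for Y
        using R G[of Y] by simp_all
      fix Y y s' assume Y: "Y \<subseteq> level_set s (regs s 8)" and step: "child_step s Y y s'"
      have *: "miss W s' \<le> R * (if y \<and> W \<subseteq> Y then 1 - child_chance W (d + 1) Y else 1)"
        using miss_child[OF W inv new step pos Y] unfolding R_def X_def d_def .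
      have "miss W s' \<le> R * (1 - G Y) + (if y = (\<exists>W\<in>Wit. W \<subseteq> Y) then 0 else R * G Y)"
      proof (cases "W \<subseteq> Y")
        case True
        then have "\<exists>W\<in>Wit. W \<subseteq> Y"
          using W by blast
        then show ?thesis
          using * True by (cases y) (auto simp: G_def algebra_simps)
      next
        case False
        then show ?thesis
          using * by (simp add: G_def)
      qed
      then show "ennreal (miss W s') \<le> ennreal (R * (1 - G Y) + (if y = (\<exists>W\<in>Wit. W \<subseteq> Y) then 0 else R * G Y))"
        by (rule ennreal_leI)
    qed
    also have "subset_avg (level_set s (regs s 8)) (\<lambda>Y. R * (1 - G Y) + \<delta> * (R * G Y)) =
        subset_avg X (\<lambda>Y. R * 1 + (- R) * ((1 - \<delta>) * G Y))"
      by (simp add: X_def d_def algebra_simps)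
    also have "\<dots> = R * (1 - subset_avg X (\<lambda>Y. (1 - \<delta>) * G Y))"
      by (simp only: subset_avg_add subset_avg_cmult) (simp add: subset_avg_const X_def algebra_simps)
    also have "\<dots> \<le> R * (if W \<subseteq> X then 1 - chance W d X / 2 ^ k else 1)"
    proof (intro mult_left_mono R)
      have ge0: "0 \<le> subset_avg X (\<lambda>Y. (1 - \<delta>) * G Y)"
        using G \<delta>1 by (intro subset_avg_nonneg mult_nonneg_nonneg) auto
      show "1 - subset_avg X (\<lambda>Y. (1 - \<delta>) * G Y) \<le> (if W \<subseteq> X then 1 - chance W d X / 2 ^ k else 1)"
      proof (cases "W \<subseteq> X")
        case True
        have "finite X"
          by (simp add: X_def)
        \<comment> \<open>The vote on \<open>Y\<close> costs one more \<open>\<delta>\<close>, so j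
          - 1 possible errors become j; averaging halves the surplus, so \<open>2 ^ (j - 1)\<close>
          becomes \<open>2 ^ j\<close>. Both changes reproduce \<open>loss\<close> at depth
          d.\<close>
        define \<alpha> where "\<alpha> = 1 / real j - real j * \<delta>"
        have avg: "subset_avg X (\<lambda>Y. \<alpha> * of_bool (W \<subseteq> Y) + (- 1 / 2 ^ (j - 1)) * (of_bool (W \<subseteq> Y) * real (card (Y - W)))) =
            (1 / real j - loss W d X) / 2 ^ k"
        proof -
          have "2 ^ j = (2 :: real) * 2 ^ (j - 1)"
            using j by (cases j) auto
          then show ?thesis
            unfolding subset_avg_add subset_avg_cmult subset_avg_superset[OF \<open>finite X\<close>]
              subset_avg_superset_card[OF \<open>finite X\<close> True]
            using True W Wit by (simp add: loss_def \<alpha>_def field_simps flip: j_def)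
        qed
        have "(1 / real j - loss W d X) / 2 ^ k \<le> subset_avg X (\<lambda>Y. (1 - \<delta>) * G Y)"
          unfolding avg[symmetric]
        proof (rule subset_avg_mono)
          fix Y
          show "\<alpha> * of_bool (W \<subseteq> Y) + (- 1 / 2 ^ (j - 1)) * (of_bool (W \<subseteq> Y) * real (card (Y - W))) \<le> (1 - \<delta>) * G Y"
          proof (cases "W \<subseteq> Y")
            case True
            have "real (D - (d + 1)) = real j - 1"
              using j by (simp add: of_nat_diff)
            then have "1 / real j - (real (card (Y - W)) / 2 ^ (j - 1) + (real j - 1) * \<delta>) \<le> G Y"
              using True j(2) by (simp add: G_def child_chance_def loss_def)
            moreover have "\<delta> * G Y \<le> \<delta>"
              using G \<delta>_nonneg by (simp add: mult_left_le)
            ultimately show ?thesis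
              using True by (simp add: \<alpha>_def algebra_simps)
          qed (simp add: G_def)
        qed
        then have "chance W d X / 2 ^ k \<le> subset_avg X (\<lambda>Y. (1 - \<delta>) * G Y)"
          using ge0 by (simp add: chance_def max_def flip: j_def)
        then show ?thesis
          using True by simp
      qed (use ge0 in simp)
    qed
    finally show ?thesis
      by (simp add: miss_s ennreal_leI)
  qed
qed

end

section \<open>The complete program\<close>

text \<open>The machine cannot multiply, but the factor \<open>M\<close> is fixed with the program,
  so the product is an expression of constant size.\<close>

primrec times_aexp :: "nat \<Rightarrow> aexp \<Rightarrow> aexp" where
  "times_aexp 0 e = Const 0"
| "times_aexp (Suc m) e = Plus e (times_aexp m e)"

lemma aval_times_aexp [simp]: "aval (times_aexp m e) s = m * aval e s"
  by (induction m) auto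

definition log_com :: com where
  "log_com = Seq (Assign 4 (Const 1)) (Seq (Assign 13 (Const 2))
     (While (Less (Reg 13) (Reg 0)) (Seq (Assign 13 (Plus (Reg 13) (Reg 13))) (Assign 4 (Plus (Reg 4) (Const 1))))))"

text \<open>The error tolerance is a constant, so it costs nothing to aim for the failure probability
  \<open>1 / q \<le> p / q\<close> by giving the root \<open>q\<close> times as many children, and to ignore \<open>p\<close>.\<close>

definition root_com :: com where
  "root_com = Seq (Assign 5 (Plus (Plus (Reg 4) (Reg 4)) (Const 4)))
     (While (Less (Reg 9) (Reg 3)) (Seq (Assign 14 (Plus (Reg 14) (Plus (Reg 5) (Reg 5)))) (Assign 9 (Plus (Reg 9) (Const 1)))))"

text \<open>One loop of \<open>k\<close> rounds computes \<open>2 ^ k\<close>, multiplies the number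
  of children of the root by it, and adds \<open>k * (L + 1)\<close> to the vote length.\<close>

definition power_com :: "nat \<Rightarrow> com" where
  "power_com M = Seq (Assign 9 (Const 0)) (Seq (Assign 6 (Const 1))
     (Seq (Assign 7 (Plus (Plus (Plus (Reg 3) (Reg 3)) (Plus (Reg 4) (Reg 4))) (Const 6)))
     (Seq (While (Less (Reg 9) (Reg 1))
        (Seq (Assign 6 (Plus (Reg 6) (Reg 6)))
        (Seq (Assign 14 (Plus (Reg 14) (Reg 14)))
        (Seq (Assign 7 (Plus (Reg 7) (Plus (Reg 4) (Const 1))))
             (Assign 9 (Plus (Reg 9) (Const 1)))))))
     (Seq (Assign 7 (times_aexp M (Reg 7)))
          (Store 0 (Const 0) (Reg 14))))))"

definition setup_com :: "nat \<Rightarrow> com" where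
  "setup_com M = Seq log_com (Seq root_com (power_com M))"

definition listing_com :: "nat \<Rightarrow> com" where
  "listing_com M = Seq (setup_com M) search_loop"

context machine
begin

definition input_state :: "nat \<Rightarrow> nat \<Rightarrow> state \<Rightarrow> bool" where
  "input_state k q s \<longleftrightarrow> regs s 0 = n \<and> regs s 1 = k \<and> regs s 3 = q \<and> regs s 8 = 0 \<and>
     arrs s = (\<lambda>_ _. 0) \<and> listed s = [] \<and> calls s = 0"

text \<open>Together with n \<le> 2^L this makes \<open>L\<close> the least such positive number, so
  it is of order log n.\<close>

definition log_bound :: "nat \<Rightarrow> bool" where
  "log_bound L \<longleftrightarrow> 1 \<le> L \<and> (L = 1 \<or> 2 ^ (L - 1) < n)"

lemma ensures_log_com:
  assumes "input_state k q s" "regs s 9 = 0" "regs s 14 = 0" "steps s = 0"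
  shows "ensures log_com (\<lambda>s. \<exists>L. input_state k q s \<and> log_bound L \<and> n \<le> 2 ^ L \<and> regs s 4 = L \<and>
     regs s 9 = 0 \<and> regs s 14 = 0 \<and> steps s \<le> 3 * L) s"
  using assms unfolding log_com_def
  apply simp
  apply (rule ensures_while[where v = "\<lambda>s. n - regs s 13" and
      I = "\<lambda>s. \<exists>L. input_state k q s \<and> log_bound L \<and> regs s 4 = L \<and> regs s 13 = 2 ^ L \<and>
     regs s 9 = 0 \<and> regs s 14 = 0 \<and> steps s + 1 \<le> 3 * L"])
  subgoal for s'
    by (auto simp: state_simps input_state_def log_bound_def mult_2 intro!: diff_less_mono2)
  subgoal for s'
    by (auto simp: state_simps input_state_def)
  subgoal
    by (simp add: state_simps input_state_def log_bound_def)
  done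

lemma ensures_root_com:
  assumes "input_state k q s" "regs s 4 = L" "regs s 9 = 0" "regs s 14 = 0" "steps s \<le> 3 * L"
  shows "ensures root_com (\<lambda>s. input_state k q s \<and> regs s 4 = L \<and> regs s 5 = 2 * L + 4 \<and>
     regs s 14 = 2 * (2 * L + 4) * q \<and> steps s \<le> 3 * L + 3 * q + 2) s"
  using assms unfolding root_com_def
  apply simp
  apply (rule ensures_while[where v = "\<lambda>s. q - regs s 9" and
      I = "\<lambda>s. input_state k q s \<and> regs s 4 = L \<and> regs s 5 = 2 * L + 4 \<and> regs s 9 \<le> q \<and>
     regs s 14 = 2 * (2 * L + 4) * regs s 9 \<and> steps s \<le> 3 * L + 3 * regs s 9 + 1"])
  subgoal for s'
    by (auto simp: state_simps input_state_def)
  subgoal for s'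
    by (auto simp: state_simps input_state_def)
  subgoal
    by (simp add: state_simps input_state_def)
  done

lemma ensures_power_com:
  assumes "input_state k q s" "regs s 4 = L" "regs s 5 = 2 * L + 4" "regs s 14 = 2 * (2 * L + 4) * q"
    "steps s \<le> 3 * L + 3 * q + 2"
  shows "ensures (power_com M) (\<lambda>s. regs s 0 = n \<and> regs s 1 = k \<and> regs s 5 = 2 * L + 4 \<and> regs s 6 = 2 ^ k \<and>
     regs s 7 = M * (2 * q + 2 * L + 6 + k * (L + 1)) \<and> regs s 8 = 0 \<and>
     arrs s 0 0 = 2 ^ k * (2 * (2 * L + 4) * q) \<and> arrs s 3 = (\<lambda>_. 0) \<and> listed s = [] \<and> calls s = 0 \<and>
     steps s \<le> 3 * L + 3 * q + 5 * k + 8) s"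
  using assms unfolding power_com_def
  apply simp
  apply (rule ensures_while[where v = "\<lambda>s. k - regs s 9" and
      I = "\<lambda>s. input_state k q s \<and> regs s 4 = L \<and> regs s 5 = 2 * L + 4 \<and> regs s 9 \<le> k \<and> regs s 6 = 2 ^ regs s 9 \<and>
     regs s 7 = 2 * q + 2 * L + 6 + regs s 9 * (L + 1) \<and>
     regs s 14 = 2 ^ regs s 9 * (2 * (2 * L + 4) * q) \<and> steps s \<le> 3 * L + 3 * q + 5 * regs s 9 + 5"])
  subgoal for s'
    by (auto simp: state_simps input_state_def algebra_simps)
  subgoal for s'
    by (auto simp: state_simps input_state_def)
  subgoal
    by (simp add: state_simps input_state_def)
  done

lemma ensures_setup_com:
  "ensures (setup_com M) (\<lambda>s. \<exists>L. log_bound L \<and> n \<le> 2 ^ L \<and>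
     regs s 0 = n \<and> regs s 1 = k \<and> regs s 5 = 2 * L + 4 \<and> regs s 6 = 2 ^ k \<and>
     regs s 7 = M * (2 * q + 2 * L + 6 + k * (L + 1)) \<and> regs s 8 = 0 \<and>
     arrs s 0 0 = 2 ^ k * (2 * (2 * L + 4) * q) \<and> arrs s 3 = (\<lambda>_. 0) \<and> listed s = [] \<and> calls s = 0 \<and>
     steps s \<le> 3 * L + 3 * q + 5 * k + 8) (init [n, k, p, q])"
proof -
  have "input_state k q (init [n, k, p, q])" "regs (init [n, k, p, q]) 9 = 0" "regs (init [n, k, p, q]) 14 = 0"
    "steps (init [n, k, p, q]) = 0"
    by (simp_all add: init_def input_state_def eval_nat_numeral)
  note 1 = ensures_log_com[OF this]
  show ?thesis
    unfolding setup_com_def ensures_simps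
  proof (rule ensures_mono[OF 1], elim exE conjE, goal_cases)
    case (1 s L)
    show ?case
    proof (rule ensures_mono[OF ensures_root_com[of k q s L]], use 1 in simp_all, elim conjE, goal_cases)
      case (1 s')
      show ?case
        by (rule ensures_mono[OF ensures_power_com[of k q s' L]]) (use 1 in auto)
    qed
  qed
qed

end

section \<open>Termination, correctness and cost of the main loop\<close>

context listing
begin

text \<open>An iteration uses up 1 of the potential; this bound keeps the conversion to
  \<open>ennreal\<close> from truncating the difference.\<close>

lemma potential_ge_1:
  assumes "0 < regs s 8 + arrs s 0 0"
  shows "1 \<le> potential s"
proof (cases "regs s 8")
  case 0
  then show ?thesis
    using assms potential_ge_weight[of s] weight_ge[of s 0] by simp
next
  case (Suc d)
  have "0 \<le> (\<Sum>i\<le>regs s 8. real (arrs s 0 i) * weight s i)"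
    by (intro sum_nonneg mult_nonneg_nonneg order_trans[OF _ weight_ge]) auto
  then show ?thesis
    by (simp add: potential_def Suc)
qed

context
  assumes small: "4 * 2 ^ k * \<delta> \<le> 1"
begin

lemma ensures_search_inv: "search_inv s \<Longrightarrow> ensures search_body search_inv (charge 1 s)"
  by (rule ensures_mono[OF ensures_search_body])
     (auto simp: pop_step_def child_step_def split: if_splits)

lemma ensures_search_loop:
  assumes "search_inv s" "listed s = []"
  shows "ensures search_loop (\<lambda>s. verified \<longrightarrow> set (listed s) \<subseteq> Wit) s"
  unfolding search_loop_def
proof (rule ensures_while_rank[where V = "\<lambda>s. ennreal (potential s)" and
      I = "\<lambda>s. search_inv s \<and> (verified \<longrightarrow> set (listed s) \<subseteq> Wit)"])
  fix s assume I: "search_inv s \<and> (verified \<longrightarrow> set (listed s) \<subseteq> Wit)"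
    and b: "bval (Less (Const 0) (Plus (Reg 8) (Arr 0 (Const 0)))) s"
  then have inv: "search_inv s" and guard: "0 < regs s 8 + arrs s 0 0"
    by auto
  show "ensures search_body (\<lambda>s. search_inv s \<and> (verified \<longrightarrow> set (listed s) \<subseteq> Wit)) (charge 1 s)"
  proof (rule ensures_mono[OF ensures_search_body[OF inv]])
    fix s'
    assume *: "if arrs s 0 (regs s 8) = 0 then pop_step s s' else
     \<exists>Y y. Y \<subseteq> level_set s (regs s 8) \<and> (y \<longrightarrow> (\<exists>i. pmf (ans i Y) True \<noteq> 0)) \<and> child_step s Y y s'"
    show "search_inv s' \<and> (verified \<longrightarrow> set (listed s') \<subseteq> Wit)"
    proof (cases "arrs s 0 (regs s 8) = 0")
      case True
      then show ?thesis
        using * I by (simp add: pop_step_def)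
    next
      case False
      then obtain Y y where Y: "Y \<subseteq> level_set s (regs s 8)" "y \<longrightarrow> (\<exists>i. pmf (ans i Y) True \<noteq> 0)"
        and step: "child_step s Y y s'"
        using * by auto
      have "Y \<subseteq> {..<n}"
        using Y level_set_subset by blast
      then have "Y \<in> Wit" if verified y "card Y = k"
        using Y(2) that unfolding verified_def by blast
      then show ?thesis
        using I step by (auto simp: child_step_def split: if_splits)
    qed
  qed
  have "wp search_body (\<lambda>s. ennreal (potential s)) (charge 1 s) \<le> ennreal (0 + 1 * (potential s - 1) + \<delta> * 0)"
    by (rule wp_search_body_cost[OF small inv guard]) auto
  then have "1 + wp search_body (\<lambda>s. ennreal (potential s)) (charge 1 s) \<le> ennreal 1 + ennreal (potential s - 1)"
    by (intro add_mono) simp_all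
  also have "\<dots> = ennreal (potential s)"
    using potential_ge_1[OF guard] by (subst ennreal_plus[symmetric]) auto
  finally show "1 + wp search_body (\<lambda>s. ennreal (potential s)) (charge 1 s) \<le> ennreal (potential s)" .
qed (use assms in \<open>auto simp: charge_def\<close>)

lemma wp_search_calls:
  assumes "search_inv s"
  shows "wp search_loop (\<lambda>s. of_nat (calls s)) s \<le> ennreal (real (calls s) + real r * potential s)"
  unfolding search_loop_def
proof (rule wp_while[where I = search_inv])
  fix s assume inv: "search_inv s" and b: "bval (Less (Const 0) (Plus (Reg 8) (Arr 0 (Const 0)))) s"
  then have guard: "0 < regs s 8 + arrs s 0 0"
    by auto
  show "ensures search_body search_inv (charge 1 s)"
    using inv by (rule ensures_search_inv)
  have "wp search_body (\<lambda>s. ennreal (real (calls s) + real r * potential s)) (charge 1 s) \<le>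
      ennreal (real (calls s + r) + real r * (potential s - 1) + \<delta> * 0)"
    by (rule wp_search_body_cost[OF small inv guard])
       (auto simp: pop_step_def child_step_def split: if_splits intro!: ennreal_leI)
  then show "wp search_body (\<lambda>s. ennreal (real (calls s) + real r * potential s)) (charge 1 s) \<le>
      ennreal (real (calls s) + real r * potential s)"
    by (simp add: algebra_simps)
qed (use assms potential_nonneg in \<open>auto simp: charge_def ennreal_of_nat_eq_real_of_nat intro!: ennreal_leI\<close>)

text \<open>The additional 1 pays for leaving the loop.\<close>

lemma wp_search_steps:
  assumes "search_inv s" tb
  shows "wp search_loop (\<lambda>s. of_nat (steps s)) s \<le> ennreal (real (steps s + 1) + real max_time * potential s)"
  unfolding search_loop_def
proof (rule wp_while[where I = search_inv])
  fix s assume inv: "search_inv s" and b: "bval (Less (Const 0) (Plus (Reg 8) (Arr 0 (Const 0)))) s"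
  then have guard: "0 < regs s 8 + arrs s 0 0"
    by auto
  show "ensures search_body search_inv (charge 1 s)"
    using inv by (rule ensures_search_inv)
  have "wp search_body (\<lambda>s. ennreal (real (steps s + 1) + real max_time * potential s)) (charge 1 s) \<le>
      ennreal (real (steps s + 1 + max_time) + real max_time * (potential s - 1) + \<delta> * 0)"
  proof (rule wp_search_body_cost[OF small inv guard])
    fix Y y s' assume "child_step s Y y s'"
    then have "steps s' \<le> steps s + max_time"
      using \<open>tb\<close> unfolding child_step_def by blast
    then show "ennreal (real (steps s' + 1) + real max_time * potential s') \<le>
        ennreal (real (steps s + 1 + max_time) + real max_time * potential s' +
          (if y = (\<exists>W\<in>Wit. W \<subseteq> Y) then 0 else 0))"
      by (intro ennreal_leI) simp
  qed (auto simp: pop_step_def intro!: ennreal_leI)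
  then show "wp search_body (\<lambda>s. ennreal (real (steps s + 1) + real max_time * potential s)) (charge 1 s) \<le>
      ennreal (real (steps s + 1) + real max_time * potential s)"
    by (simp add: algebra_simps)
qed (use assms potential_nonneg in \<open>auto simp: charge_def ennreal_of_nat_eq_real_of_nat intro!: ennreal_leI\<close>)

text \<open>A union bound: an iteration lists a non-witness with probability at most
  \<open>\<delta>\<close>, and the potential bounds the expected number of iterations.\<close>

lemma wp_search_false_positive:
  assumes "search_inv s" "listed s = []"
  shows "wp search_loop (\<lambda>s. of_bool (\<not> set (listed s) \<subseteq> Wit)) s \<le> ennreal (\<delta> * potential s)"
proof -
  let ?f = "\<lambda>s. ennreal (of_bool (\<not> set (listed s) \<subseteq> Wit) + \<delta> * potential s)"
  have "wp search_loop (\<lambda>s. of_bool (\<not> set (listed s) \<subseteq> Wit)) s \<le> ?f s"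
    unfolding search_loop_def
  proof (rule wp_while[where I = search_inv])
    fix s assume inv: "search_inv s" and b: "bval (Less (Const 0) (Plus (Reg 8) (Arr 0 (Const 0)))) s"
    then have guard: "0 < regs s 8 + arrs s 0 0"
      by auto
    show "ensures search_body search_inv (charge 1 s)"
      using inv by (rule ensures_search_inv)
    have "wp search_body ?f (charge 1 s) \<le>
        ennreal (of_bool (\<not> set (listed s) \<subseteq> Wit) + \<delta> * (potential s - 1) + \<delta> * 1)"
    proof (rule wp_search_body_cost[OF small inv guard])
      fix Y y s' assume Y: "Y \<subseteq> level_set s (regs s 8)" and step: "child_step s Y y s'"
      have "finite Y"
        using Y finite_subset finite_level_set by blast
      \<comment> \<open>A set of \<open>k\<close> elements that contains a witness is that witness,
        so listing a non-witness requires a wrong vote.\<close>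
      then have "W = Y" if "W \<in> Wit" "W \<subseteq> Y" "card Y = k" for W
        using that Wit[of W] by (metis card_subset_eq)
      then have "Y \<in> Wit" if "\<exists>W\<in>Wit. W \<subseteq> Y" "card Y = k"
        using that by blast
      then have "of_bool (\<not> set (listed s') \<subseteq> Wit) \<le>
          of_bool (\<not> set (listed s) \<subseteq> Wit) + (if y = (\<exists>W\<in>Wit. W \<subseteq> Y) then 0 else 1 :: real)"
        using step by (auto simp: child_step_def split: if_splits)
      then show "?f s' \<le> ennreal (of_bool (\<not> set (listed s) \<subseteq> Wit) + \<delta> * potential s' +
          (if y = (\<exists>W\<in>Wit. W \<subseteq> Y) then 0 else 1))"
        by (intro ennreal_leI) linarith
    qed (auto simp: pop_step_def \<delta>_nonneg)
    then show "wp search_body ?f (charge 1 s) \<le> ?f s"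
      by (simp add: algebra_simps)
  qed (use assms potential_nonneg \<delta>_nonneg in \<open>auto simp: charge_def\<close>)
  then show ?thesis
    using assms by simp
qed

lemma wp_search_miss:
  assumes "search_inv s" "W \<in> Wit"
  shows "wp search_loop (\<lambda>s. of_bool (W \<notin> set (listed s))) s \<le> ennreal (miss W s)"
  unfolding search_loop_def
proof (rule wp_while[where I = search_inv])
  fix s assume inv: "search_inv s" and b: "bval (Less (Const 0) (Plus (Reg 8) (Arr 0 (Const 0)))) s"
  then have guard: "0 < regs s 8 + arrs s 0 0"
    by auto
  show "ensures search_body search_inv (charge 1 s)"
    using inv by (rule ensures_search_inv)
  show "wp search_body (\<lambda>s. ennreal (miss W s)) (charge 1 s) \<le> ennreal (miss W s)"
    by (rule wp_search_body_miss[OF small assms(2) inv guard])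
next
  fix s assume "\<not> bval (Less (Const 0) (Plus (Reg 8) (Arr 0 (Const 0)))) s"
  then show "of_bool (W \<notin> set (listed (charge 1 s))) \<le> ennreal (miss W s)"
    by (simp add: charge_def miss_def miss_factor_def)
qed (use assms in auto)

end

end

section \<open>Numerical estimates for the chosen parameters\<close>

lemma (in machine) log_bound_le:
  assumes "log_bound L"
  shows "real L \<le> 2 * log 2 (real (max 2 n))"
proof -
  define l where "l = log 2 (real (max 2 n))"
  have log: "1 \<le> l"
    by (simp add: l_def le_log_iff)
  have "real L \<le> 2 * l"
  proof (cases "L = 1")
    case False
    then have "1 \<le> L" "2 ^ (L - 1) < n"
      using assms by (auto simp: log_bound_def)
    then have "real (2 ^ (L - 1)) \<le> real (max 2 n)"
      unfolding of_nat_le_iff by simp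
    then have "real (L - 1) \<le> l"
      by (simp add: l_def le_log_iff powr_realpow)
    moreover have "real (L - 1) = real L - 1"
      using \<open>1 \<le> L\<close> by simp
    ultimately show ?thesis
      using log by linarith
  qed (use log in simp)
  then show ?thesis
    by (simp only: l_def)
qed

text \<open>The program does not know the number of witnesses; the vote length has to rely on this a
  priori bound.\<close>

lemma (in witness_instance) card_Wit_le:
  assumes "n \<le> 2 ^ L"
  shows "max 1 (card Wit) \<le> 2 ^ (L * k)"
proof -
  have "card Wit \<le> card {X. X \<subseteq> {..<n} \<and> card X = k}"
    using Wit by (intro card_mono) auto
  also have "\<dots> = n choose k"
    using n_subsets[of "{..<n}" k] by simp
  also have "\<dots> \<le> n ^ k"
    by (cases "k \<le> n") (auto simp: binomial_le_pow binomial_eq_0)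
  also have "\<dots> \<le> (2 ^ L) ^ k"
    using assms by (rule power_mono) simp
  finally show ?thesis
    by (simp add: power_mult)
qed

text \<open>The situation after the setup. Each block of \<open>M\<close> calls halves the error
  bound of a vote, so \<open>R\<close> blocks make it at most \<open>2 ^ -R\<close>. The value of
  \<open>R\<close> comes from \<open>false_positive_le\<close>, that of \<open>D\<close> from
  \<open>chance_start_ge\<close>.\<close>

locale listing_start = listing n ans t k Wit c tb \<tau> D r
  for n ans t k Wit c tb \<tau> D r +
  fixes L M q R :: nat and s0 :: state
  assumes D: "D = 2 * L + 4" and R: "R = 2 * q + 2 * L + 6 + k * (L + 1)" and r: "r = M * R"
    and q: "0 < q" and L: "log_bound L" "n \<le> 2 ^ L"
    and M: "(1 - (1 - 2 * c)\<^sup>2 / 2) ^ M \<le> 1 / 2"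
    and s0: "search_inv s0" "regs s0 8 = 0" "arrs s0 0 0 = 2 ^ k * (2 * D * q)" "arrs s0 3 = (\<lambda>_. 0)"
      "listed s0 = []" "calls s0 = 0" "steps s0 \<le> 3 * L + 3 * q + 5 * k + 8"
begin

definition N :: real where
  "N = real (max 1 (card Wit))"

lemma N_ge_1: "1 \<le> N" and card_Wit_le_N: "real (card Wit) \<le> N"
  by (simp_all add: N_def)

lemma \<delta>_le: "2 ^ R * \<delta> \<le> 1"
proof -
  have "(1 - 2 * c)\<^sup>2 \<le> 1"
    using c by (intro power_le_one) auto
  then have "\<delta> \<le> (1 / 2) ^ R"
    unfolding \<delta>_def unfolding r power_mult using M by (intro power_mono zero_le_power) auto
  then show ?thesis
    by (simp add: power_one_over field_simps)
qed

lemma power_\<delta>_le: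
  assumes "e \<le> R"
  shows "2 ^ e * \<delta> \<le> 1"
proof -
  have "2 ^ e * \<delta> \<le> 2 ^ R * \<delta>"
    using assms \<delta>_nonneg by (intro mult_right_mono power_increasing) auto
  then show ?thesis
    using \<delta>_le by linarith
qed

lemma small: "4 * 2 ^ k * \<delta> \<le> 1"
  using power_\<delta>_le[of "k + 2"] by (simp add: R power_add mult.commute)

lemma D_le: "real D \<le> 2 ^ (L + 2)"
proof -
  have "L + 2 \<le> 2 ^ (L + 1)"
    using less_exp[of "L + 1"] by linarith
  then have "real (L + 2) \<le> 2 ^ (L + 1)"
    by (metis of_nat_le_iff of_nat_numeral of_nat_power)
  then show ?thesis
    by (simp add: D)
qed

lemma D_pos: "1 \<le> D"
  by (simp add: D)

lemma level_set_start: "level_set s0 0 = {..<n}"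
  by (auto simp: level_set_def)

lemma potential_start_le: "potential s0 \<le> 10 * 2 ^ k * real q * (real D)\<^sup>2 * N"
proof -
  have "num_wit {..<n} = card Wit"
    unfolding num_wit_def using Wit by (intro arg_cong[where f = card]) auto
  then have "potential s0 = real (2 ^ k * (2 * D * q)) * (3 * real D * real (card Wit) + 2)"
    using s0 by (simp add: potential_def weight_def level_set_start)
  also have "\<dots> \<le> real (2 ^ k * (2 * D * q)) * (3 * real D * N + 2 * real D * N)"
  proof (intro mult_left_mono add_mono card_Wit_le_N)
    have "2 * 1 * 1 \<le> 2 * real D * N"
      using N_ge_1 D_pos by (intro mult_mono) auto
    then show "2 \<le> 2 * real D * N"
      by simp
  qed auto
  also have "\<dots> = 10 * 2 ^ k * real q * (real D)\<^sup>2 * N"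
    by (simp add: power2_eq_square algebra_simps)
  finally show ?thesis .
qed

lemma false_positive_le: "\<delta> * potential s0 \<le> 1 / real q"
proof -
  \<comment> \<open>The summands are exponents of powers of two bounding 10, \<open>2 ^ k\<close>,
    the square of \<open>D\<close>, and \<open>N\<close>; with 2(q - 1) for the square of
    \<open>q\<close> they add up to exactly \<open>R\<close>.\<close>
  define e where "e = 4 + k + 2 * (L + 2) + L * k"
  have "(real D)\<^sup>2 \<le> (2 ^ (L + 2))\<^sup>2"
    using D_le by (intro power_mono) auto
  moreover have "N \<le> 2 ^ (L * k)"
    using card_Wit_le[OF L(2)] unfolding N_def by (metis of_nat_le_iff of_nat_numeral of_nat_power)
  ultimately have "10 * 2 ^ k * real q * (real D)\<^sup>2 * N \<le> 2 ^ 4 * 2 ^ k * real q * (2 ^ (L + 2))\<^sup>2 * 2 ^ (L * k)"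
    using N_ge_1 by (intro mult_mono) auto
  also have "\<dots> = 2 ^ e * real q"
    by (simp add: e_def power_add power_mult[symmetric] mult.commute)
  finally have "potential s0 \<le> 2 ^ e * real q"
    using potential_start_le by linarith
  then have "\<delta> * potential s0 * real q \<le> \<delta> * (2 ^ e * real q) * real q"
    using \<delta>_nonneg by (intro mult_right_mono mult_left_mono) auto
  also have "\<dots> = 2 ^ e * \<delta> * (real q * real q)"
    by (simp add: algebra_simps)
  also have "\<dots> \<le> 2 ^ e * \<delta> * (2 ^ (q - 1) * 2 ^ (q - 1))"
  proof -
    have "q \<le> 2 ^ (q - 1)"
      using less_exp[of "q - 1"] q by linarith
    then have "real q \<le> 2 ^ (q - 1)"
      by (metis of_nat_le_iff of_nat_numeral of_nat_power)
    then show ?thesis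
      using \<delta>_nonneg by (intro mult_left_mono mult_mono) auto
  qed
  also have "\<dots> = 2 ^ (e + (q - 1) + (q - 1)) * \<delta>"
    by (simp only: power_add mult_ac)
  also have "\<dots> \<le> 1"
    using q by (intro power_\<delta>_le) (simp add: e_def R algebra_simps)
  finally show ?thesis
    using q by (simp add: field_simps)
qed

text \<open>Halving at most 2^L elements \<open>D = 2 * L + 4\<close> times leaves an expected
  surplus of at most 2^-(L + 4) \<le> 1/(4D). The errors cost at most another 1/(4D), so half of 1/D
  remains.\<close>

lemma chance_start_ge: "1 / (2 * real D) \<le> chance W 0 {..<n}"
proof -
  have D_pos': "0 < real D"
    using D_pos by simp
  have "card ({..<n} - W) \<le> card {..<n}"
    by (intro card_mono) auto
  then have "real (card ({..<n} - W)) \<le> 2 ^ L"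
    using L(2) by (metis card_lessThan of_nat_le_iff of_nat_numeral of_nat_power order_trans)
  then have "real (card ({..<n} - W)) / 2 ^ D \<le> 2 ^ L / 2 ^ D"
    by (intro divide_right_mono) auto
  also have "\<dots> = 1 / (4 * 2 ^ (L + 2))"
  proof -
    have "D = L + (2 + (L + 2))"
      by (simp add: D)
    then have "(2::real) ^ D = 2 ^ L * (2 ^ 2 * 2 ^ (L + 2))"
      by (simp only: power_add)
    then show ?thesis
      by simp
  qed
  also have "\<dots> \<le> 1 / (4 * real D)"
    using D_le D_pos' by (intro divide_left_mono mult_pos_pos) auto
  finally have 1: "real (card ({..<n} - W)) / 2 ^ D \<le> 1 / (4 * real D)" .
  have "4 * real D * real D * \<delta> \<le> 4 * 2 ^ (L + 2) * 2 ^ (L + 2) * \<delta>"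
    using D_le \<delta>_nonneg by (intro mult_right_mono mult_mono) auto
  also have "\<dots> = 2 ^ (2 + (L + 2) + (L + 2)) * \<delta>"
    by (simp add: power_add)
  also have "\<dots> \<le> 1"
    by (intro power_\<delta>_le) (simp add: R)
  finally have "real D * \<delta> \<le> 1 / (4 * real D)"
    using D_pos' by (simp add: field_simps)
  then have "1 / real D - 1 / (4 * real D) - 1 / (4 * real D) \<le> chance W 0 {..<n}"
    using 1 unfolding chance_def loss_def by simp
  then show ?thesis
    using D_pos' by (simp add: field_simps)
qed

text \<open>The factor for one child of the root is at most 1 - 1/(2^k 2D). Its power over all 2^k
  2Dq children is at most exp(-q), hence at most 1/q.\<close>

lemma miss_start_le:
  assumes "W \<in> Wit"
  shows "miss W s0 \<le> 1 / real q"
proof -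
  define x where "x = chance W 0 {..<n} / 2 ^ k"
  have "1 / (2 * real D) / 2 ^ k \<le> x"
    unfolding x_def by (intro divide_right_mono chance_start_ge) simp
  moreover have "0 < 2 * real D * 2 ^ k"
    using D_pos by (intro mult_pos_pos) auto
  ultimately have "1 \<le> x * (2 * real D * 2 ^ k)"
    by (simp add: field_simps)
  then have "1 * real q \<le> x * (2 * real D * 2 ^ k) * real q"
    by (intro mult_right_mono) auto
  then have ge: "real q \<le> real (2 ^ k * (2 * D * q)) * x"
    by (simp add: algebra_simps)
  have "W \<subseteq> {..<n}"
    using assms Wit by blast
  then have "miss W s0 = (1 - x) ^ (2 ^ k * (2 * D * q))"
    using s0 by (simp add: miss_def miss_factor_def level_set_start x_def)
  also have "\<dots> \<le> exp (- x) ^ (2 ^ k * (2 * D * q))"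
    using exp_ge_add_one_self[of "- x"] chance_bounds[of W 0 "{..<n}"] by (intro power_mono) (auto simp: x_def)
  also have "\<dots> = exp (- (real (2 ^ k * (2 * D * q)) * x))"
    by (simp add: exp_of_nat_mult[symmetric])
  also have "\<dots> \<le> exp (- real q)"
    using ge by simp
  also have "\<dots> \<le> 1 / real q"
  proof -
    have "real q \<le> exp (real q)"
      using exp_ge_add_one_self[of "real q"] by linarith
    then show ?thesis
      using q by (simp add: exp_minus field_simps)
  qed
  finally show ?thesis .
qed

text \<open>\<open>l\<close> stands for log n when calls are counted and for n itself in the time
  bound, where any polynomial will do.\<close>

lemma R_le:
  assumes "1 \<le> l" "real L \<le> 2 * l"
  shows "real R \<le> (2 * real q + 13) * 2 ^ k * l"
proof -
  have "real k \<le> 2 ^ k"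
    using less_exp[of k] by (metis of_nat_le_iff of_nat_numeral of_nat_power less_imp_le)
  have "real R = (2 * real q + 6) + 2 * real L + real k * (real L + 1)"
    by (simp add: R algebra_simps)
  also have "\<dots> \<le> (2 * real q + 6) * l + 4 * l + real k * (3 * l)"
    using assms mult_left_mono[of 1 l "2 * real q + 6"] by (intro add_mono mult_left_mono) auto
  also have "\<dots> = (2 * real q + 10) * l * 1 + 3 * l * real k"
    by (simp add: algebra_simps)
  also have "\<dots> \<le> (2 * real q + 10) * l * 2 ^ k + 3 * l * 2 ^ k"
    using assms \<open>real k \<le> 2 ^ k\<close> by (intro add_mono mult_left_mono) auto
  finally show ?thesis
    by (simp add: algebra_simps)
qed

lemma potential_start_le':
  assumes "1 \<le> l" "real L \<le> 2 * l"
  shows "potential s0 \<le> 640 * real q * 2 ^ k * l\<^sup>2 * N"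
proof -
  have "real D \<le> 8 * l"
    using assms by (simp add: D)
  then have "(real D)\<^sup>2 \<le> (8 * l)\<^sup>2"
    by (intro power_mono) auto
  then have "10 * 2 ^ k * real q * (real D)\<^sup>2 * N \<le> 10 * 2 ^ k * real q * (8 * l)\<^sup>2 * N"
    using N_ge_1 by (intro mult_right_mono mult_left_mono) auto
  then show ?thesis
    using potential_start_le by (simp add: power_mult_distrib algebra_simps)
qed

text \<open>In \<open>4 ^ k\<close> one factor \<open>2 ^ k\<close> is the number of children of a
  node and the other bounds the linear dependence of the vote length on \<open>k\<close>.\<close>

lemma calls_le:
  assumes "1 \<le> l" "real L \<le> 2 * l"
  shows "real r * potential s0 \<le> 640 * real M * real q * (2 * real q + 13) * 4 ^ k * l ^ 3 * N"
proof -
  have "real r * potential s0 \<le> (real M * ((2 * real q + 13) * 2 ^ k * l)) * (640 * real q * 2 ^ k * l\<^sup>2 * N)"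
    using R_le[OF assms] potential_start_le'[OF assms] potential_nonneg assms N_ge_1
    unfolding r of_nat_mult by (intro mult_mono mult_left_mono) auto
  also have "\<dots> = 640 * real M * real q * (2 * real q + 13) * (2 ^ k * 2 ^ k) * l ^ 3 * N"
    by (simp add: power2_eq_square power3_eq_cube)
  also have "(2 ^ k * 2 ^ k :: real) = 4 ^ k"
    by (simp flip: power_mult_distrib)
  finally show ?thesis .
qed

lemma steps_le:
  assumes "1 \<le> \<tau>" and m: "m = real (max 2 n)"
  shows "real (steps s0 + 1) + real max_time * potential s0 \<le>
    (3 * real q + 20 + (22 + 4 * real M * (2 * real q + 13)) * 640 * real q) * 4 ^ k * real \<tau> * m ^ 3 * N"
proof -
  have m1: "1 \<le> m"
    using m by simp
  have "real (max 2 n) \<le> 2 ^ max 2 n"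
    using less_exp[of "max 2 n"] by (metis of_nat_le_iff of_nat_numeral of_nat_power less_imp_le)
  then have "log 2 m \<le> m"
    using m1 by (simp add: log_le_iff m powr_realpow)
  then have L: "real L \<le> 2 * m"
    using log_bound_le[OF L(1), folded m] by linarith
  have p4: "(2 ^ k * 2 ^ k :: real) = 4 ^ k"
    by (simp flip: power_mult_distrib)
  have k: "real k \<le> 2 ^ k"
    using less_exp[of k] by (metis of_nat_le_iff of_nat_numeral of_nat_power less_imp_le)
  \<comment> \<open>Up to constants, \<open>T\<close> bounds the time of one iteration and
    \<open>P\<close> below the initial potential.\<close>
  define T where "T = 2 ^ k * real \<tau> * m"
  have "1 * 1 * 1 \<le> T"
    unfolding T_def using assms m1 by (intro mult_mono) auto
  have Tm: "m \<le> T"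
  proof -
    have "1 * 1 * m \<le> T"
      unfolding T_def using assms m1 by (intro mult_mono) auto
    then show ?thesis by simp
  qed
  have Tk: "real k \<le> T"
  proof -
    have "real k * 1 * 1 \<le> T"
      unfolding T_def using assms m1 k by (intro mult_mono) auto
    then show ?thesis by simp
  qed
  have "real (steps s0 + 1) \<le> 3 * real L + 3 * real q + 5 * real k + 9"
    using s0(7) by linarith
  also have "\<dots> \<le> 6 * T + 3 * real q * T + 5 * T + 9 * T"
    using L Tm Tk \<open>1 * 1 * 1 \<le> T\<close> mult_left_mono[of 1 T "3 * real q"] by linarith
  finally have 1: "real (steps s0 + 1) \<le> (3 * real q + 20) * T"
    by (simp add: algebra_simps)
  have "real max_time = 9 * real n + 13 + (real \<tau> + 3) * (real M * real R)"
    unfolding max_time_def by (simp add: r)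
  also have "\<dots> \<le> 9 * T + 13 * T + (4 * real \<tau>) * (real M * ((2 * real q + 13) * 2 ^ k * m))"
    using Tm m \<open>1 * 1 * 1 \<le> T\<close> R_le[OF m1 L] assms by (intro add_mono mult_mono mult_left_mono) auto
  also have "\<dots> = (22 + 4 * real M * (2 * real q + 13)) * T"
    by (simp add: T_def algebra_simps)
  finally have 2: "real max_time \<le> (22 + 4 * real M * (2 * real q + 13)) * T" .
  define P where "P = 2 ^ k * m\<^sup>2 * N"
  have "1 * 1 * 1 \<le> P"
    unfolding P_def using m1 N_ge_1 by (intro mult_mono) auto
  have "real (steps s0 + 1) + real max_time * potential s0 \<le>
      (3 * real q + 20) * T * P + ((22 + 4 * real M * (2 * real q + 13)) * T) * (640 * real q * P)"
  proof (intro add_mono mult_mono 2)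
    have "(3 * real q + 20) * T * 1 \<le> (3 * real q + 20) * T * P"
      using \<open>1 * 1 * 1 \<le> P\<close> \<open>1 * 1 * 1 \<le> T\<close> by (intro mult_left_mono) auto
    then show "real (steps s0 + 1) \<le> (3 * real q + 20) * T * P"
      using 1 by linarith
    show "potential s0 \<le> 640 * real q * P"
      using potential_start_le'[OF m1 L] by (simp add: P_def mult.assoc)
  qed (use \<open>1 * 1 * 1 \<le> T\<close> potential_nonneg in auto)
  also have "\<dots> = (3 * real q + 20 + (22 + 4 * real M * (2 * real q + 13)) * 640 * real q) * (T * P)"
    by (simp add: algebra_simps)
  also have "T * P = 4 ^ k * real \<tau> * m ^ 3 * N"
    unfolding p4[symmetric] by (simp add: T_def P_def power2_eq_square power3_eq_cube)
  finally show ?thesis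
    by (simp add: mult.assoc)
qed

end

section \<open>Guarantees of the complete program\<close>

context witness_instance
begin

context
  fixes M p q :: nat
  assumes q: "0 < q" and M: "(1 - (1 - 2 * c)\<^sup>2 / 2) ^ M \<le> 1 / 2"
begin

lemma ensures_listing_start:
  "ensures (setup_com M) (\<lambda>s. \<exists>L R. listing_start n ans t k Wit c tb \<tau> (2 * L + 4) (M * R) L M q R s) (init [n, k, p, q])"
proof (rule ensures_mono[OF ensures_setup_com], elim exE conjE, intro exI)
  fix s :: state and L
  let ?R = "2 * q + 2 * L + 6 + k * (L + 1)"
  assume *: "log_bound L" "n \<le> 2 ^ L" "regs s 0 = n" "regs s 1 = k" "regs s 5 = 2 * L + 4" "regs s 6 = 2 ^ k"
    "regs s 7 = M * ?R" "regs s 8 = 0" "arrs s 0 0 = 2 ^ k * (2 * (2 * L + 4) * q)" "arrs s 3 = (\<lambda>_. 0)"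
    "listed s = []" "calls s = 0" "steps s \<le> 3 * L + 3 * q + 5 * k + 8"
  interpret listing n ans t k Wit c tb \<tau> "2 * L + 4" "M * ?R" ..
  have "search_inv s"
    unfolding search_inv_def using * by simp
  then show "listing_start n ans t k Wit c tb \<tau> (2 * L + 4) (M * ?R) L M q ?R s"
    by unfold_locales (use * q M in auto)
qed

lemma ensures_listing_com:
  "ensures (listing_com M) (\<lambda>s. verified \<longrightarrow> set (listed s) \<subseteq> Wit) (init [n, k, p, q])"
  unfolding listing_com_def ensures_simps
proof (rule ensures_mono[OF ensures_listing_start], elim exE)
  fix s L R assume "listing_start n ans t k Wit c tb \<tau> (2 * L + 4) (M * R) L M q R s"
  then interpret listing_start n ans t k Wit c tb \<tau> "2 * L + 4" "M * R" L M q R s .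
  show "ensures search_loop (\<lambda>s. verified \<longrightarrow> set (listed s) \<subseteq> Wit) s"
    using small s0(1,5) by (rule ensures_search_loop)
qed

lemma wp_listing_false_positive:
  "wp (listing_com M) (\<lambda>s. of_bool (\<not> set (listed s) \<subseteq> Wit)) (init [n, k, p, q]) \<le> ennreal (1 / real q)"
  unfolding listing_com_def wp_simps
proof (rule wp_le_ensures[OF ensures_listing_start], elim exE)
  fix s L R assume "listing_start n ans t k Wit c tb \<tau> (2 * L + 4) (M * R) L M q R s"
  then interpret listing_start n ans t k Wit c tb \<tau> "2 * L + 4" "M * R" L M q R s .
  show "wp search_loop (\<lambda>s. of_bool (\<not> set (listed s) \<subseteq> Wit)) s \<le> ennreal (1 / real q)"
    using wp_search_false_positive[OF small s0(1,5)] ennreal_leI[OF false_positive_le] by (rule order_trans)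
qed

lemma wp_listing_miss:
  assumes "W \<in> Wit"
  shows "wp (listing_com M) (\<lambda>s. of_bool (W \<notin> set (listed s))) (init [n, k, p, q]) \<le> ennreal (1 / real q)"
  unfolding listing_com_def wp_simps
proof (rule wp_le_ensures[OF ensures_listing_start], elim exE)
  fix s L R assume "listing_start n ans t k Wit c tb \<tau> (2 * L + 4) (M * R) L M q R s"
  then interpret listing_start n ans t k Wit c tb \<tau> "2 * L + 4" "M * R" L M q R s .
  show "wp search_loop (\<lambda>s. of_bool (W \<notin> set (listed s))) s \<le> ennreal (1 / real q)"
    using wp_search_miss[OF small s0(1) assms] ennreal_leI[OF miss_start_le[OF assms]] by (rule order_trans)
qed

lemma wp_listing_calls:
  "wp (listing_com M) (\<lambda>s. of_nat (calls s)) (init [n, k, p, q]) \<le>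
     ennreal (640 * real M * real q * (2 * real q + 13) * 4 ^ k * log 2 (real (max 2 n)) ^ 3 * real (max 1 (card Wit)))"
  unfolding listing_com_def wp_simps
proof (rule wp_le_ensures[OF ensures_listing_start], elim exE)
  fix s L R assume "listing_start n ans t k Wit c tb \<tau> (2 * L + 4) (M * R) L M q R s"
  then interpret listing_start n ans t k Wit c tb \<tau> "2 * L + 4" "M * R" L M q R s .
  have "1 \<le> log 2 (real (max 2 n))"
    by (simp add: le_log_iff)
  note calls_le[OF this log_bound_le[OF L(1)]]
  then have "real (calls s) + real (M * R) * potential s \<le>
      640 * real M * real q * (2 * real q + 13) * 4 ^ k * log 2 (real (max 2 n)) ^ 3 * real (max 1 (card Wit))"
    unfolding s0(6) N_def by simp
  then show "wp search_loop (\<lambda>s. of_nat (calls s)) s \<le>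
      ennreal (640 * real M * real q * (2 * real q + 13) * 4 ^ k * log 2 (real (max 2 n)) ^ 3 * real (max 1 (card Wit)))"
    using wp_search_calls[OF small s0(1)] by (meson ennreal_leI order_trans)
qed

lemma wp_listing_steps:
  assumes tb "1 \<le> \<tau>"
  shows "wp (listing_com M) (\<lambda>s. of_nat (steps s)) (init [n, k, p, q]) \<le>
     ennreal ((3 * real q + 20 + (22 + 4 * real M * (2 * real q + 13)) * 640 * real q) * 4 ^ k * real \<tau> *
       real (max 2 n) ^ 3 * real (max 1 (card Wit)))"
  unfolding listing_com_def wp_simps
proof (rule wp_le_ensures[OF ensures_listing_start], elim exE)
  fix s L R assume "listing_start n ans t k Wit c tb \<tau> (2 * L + 4) (M * R) L M q R s"
  then interpret listing_start n ans t k Wit c tb \<tau> "2 * L + 4" "M * R" L M q R s .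
  show "wp search_loop (\<lambda>s. of_nat (steps s)) s \<le>
     ennreal ((3 * real q + 20 + (22 + 4 * real M * (2 * real q + 13)) * 640 * real q) * 4 ^ k * real \<tau> *
       real (max 2 n) ^ 3 * real (max 1 (card Wit)))"
    using wp_search_steps[OF small s0(1) \<open>tb\<close>] ennreal_leI[OF steps_le[OF assms(2) refl]]
    unfolding N_def by (rule order_trans)
qed

end

end

text \<open>A diverging run counts neither as success nor as failure, so losslessness is what turns
  a bound on failure into one on success.\<close>

lemma measure_spmf_ge_of_nn_integral_le:
  assumes "lossless_spmf p" "(\<integral>\<^sup>+ x. of_bool (\<not> P x) \<partial>measure_spmf p) \<le> ennreal e" "0 \<le> e"
  shows "1 - e \<le> measure (measure_spmf p) {x. P x}"
proof -
  have "(\<integral>\<^sup>+ x. of_bool (\<not> P x) \<partial>measure_spmf p) = (\<integral>\<^sup>+ x. indicator {x. \<not> P x} x \<partial>measure_spmf p)"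
    by (intro nn_integral_cong) (auto split: split_indicator)
  then have "emeasure (measure_spmf p) {x. \<not> P x} \<le> ennreal e"
    using assms by simp
  then have "measure (measure_spmf p) {x. \<not> P x} \<le> e"
    using \<open>0 \<le> e\<close> by (simp add: measure_spmf.emeasure_eq_measure)
  moreover have "measure (measure_spmf p) (space (measure_spmf p) - {x. \<not> P x}) =
      measure (measure_spmf p) (space (measure_spmf p)) - measure (measure_spmf p) {x. \<not> P x}"
    by (rule measure_spmf.finite_measure_compl) simp
  moreover have "space (measure_spmf p) - {x. \<not> P x} = {x. P x}"
    by (auto simp: space_measure_spmf)
  moreover have "measure (measure_spmf p) (space (measure_spmf p)) = 1"
    using assms by (simp add: lossless_spmf_def)
  ultimately show ?thesis
    by simp
qed

text \<open>Constants depending on the oracle's error bound and on \<open>q\<close> can be absorbed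
  into the exponent, because the O-notation concerns large \<open>k\<close> only.\<close>

lemma bigo_linear_const: "(\<lambda>k. a + 2 * real k) \<in> O(\<lambda>k. real k)"
proof (rule bigoI[where c = "\<bar>a\<bar> + 2"], rule eventually_sequentiallyI[of 1])
  fix k :: nat assume "1 \<le> k"
  then have "\<bar>a\<bar> * 1 \<le> \<bar>a\<bar> * real k"
    by (intro mult_left_mono) auto
  then show "norm (a + 2 * real k) \<le> (\<bar>a\<bar> + 2) * norm (real k)"
    by (simp add: algebra_simps)
qed

lemma powr_linear_const: "0 < K \<Longrightarrow> 2 powr (log 2 K + 2 * real k) = K * 4 ^ k"
proof -
  assume "0 < K"
  have "(2::real) powr (2 * real k) = 2 ^ (2 * k)"
    by (simp flip: powr_realpow)
  also have "\<dots> = 4 ^ k"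
    by (simp add: power_mult)
  finally show ?thesis
    using \<open>0 < K\<close> by (simp add: powr_add)
qed

theorem theorem2:
  fixes \<P> :: "'i problem" and \<O> :: "'i decision_oracle" and c :: real
  assumes "k_witness_problem \<P>"
    and "randomised_decision_oracle \<P> \<O> c"
    and "c < 1/2"
  shows "\<exists>P. \<forall>p q :: nat. 0 < p \<longrightarrow> 0 < q \<longrightarrow>
    \<comment> \<open>termination and correctness, for \<open>\<epsilon> = p / q\<close>\<close>
    (\<forall>I\<in>instances \<P>.
       lossless_spmf (run \<P> \<O> P I p q) \<and>
       measure (measure_spmf (run \<P> \<O> P I p q)) {s. set (listed s) \<subseteq> witnesses \<P> I}
         \<ge> 1 - real p / real q \<and>
       (verifies_candidates \<P> \<O> I \<longrightarrow>
         (\<forall>s\<in>set_spmf (run \<P> \<O> P I p q). set (listed s) \<subseteq> witnesses \<P> I)) \<and>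
       (\<forall>W\<in>witnesses \<P> I.
         measure (measure_spmf (run \<P> \<O> P I p q)) {s. W \<in> set (listed s)}
           \<ge> 1 - real p / real q)) \<and>
    \<comment> \<open>expected number of calls\<close>
    (\<exists>f :: nat \<Rightarrow> real. f \<in> O(\<lambda>k. real k) \<and>
      (\<forall>I\<in>instances \<P>.
        expected calls (run \<P> \<O> P I p q)
          \<le> ennreal (2 powr f (param \<P> I) * log 2 (size' \<P> I) ^ 3 * num_witnesses' \<P> I))) \<and>
    \<comment> \<open>expected running time\<close>
    (\<forall>g d. computable g \<longrightarrow>
      (\<forall>I\<in>instances \<P>. \<forall>i. \<forall>X\<subseteq>{..<univ_size \<P> I}.
         call_time \<O> I i X \<le> g (param \<P> I) * size' \<P> I ^ d) \<longrightarrow>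
      (\<exists>(f :: nat \<Rightarrow> real) e. f \<in> O(\<lambda>k. real k) \<and>
        (\<forall>I\<in>instances \<P>.
          expected steps (run \<P> \<O> P I p q)
            \<le> ennreal (2 powr f (param \<P> I) * g (param \<P> I) * size' \<P> I ^ e * num_witnesses' \<P> I))))"
proof -
  \<comment> \<open>Raising the error bound only weakens the assumption on the oracle and keeps the
    base 1/(2c) well defined.\<close>
  define c' where "c' = max c (1 / 4)"
  have c': "1 / 4 \<le> c'" "c' < 1 / 2" "c \<le> c'"
    using assms(3) by (auto simp: c'_def)
  have "1 - (1 - 2 * c')\<^sup>2 / 2 < 1"
    using c' by simp
  \<comment> \<open>\<open>M\<close> depends on \<open>c\<close> alone, so one program serves all
    values of \<open>p\<close> and \<open>q\<close>.\<close>
  then obtain M where M: "(1 - (1 - 2 * c')\<^sup>2 / 2) ^ M < 1 / 2"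
    using real_arch_pow_inv[of "1 / 2" "1 - (1 - 2 * c')\<^sup>2 / 2"] by auto
  then have M_le: "(1 - (1 - 2 * c')\<^sup>2 / 2) ^ M \<le> 1 / 2"
    by simp
  have "0 < M"
    using M by (cases M) auto
  have inst: "witness_instance (univ_size \<P> I) (answer \<O> I) (call_time \<O> I) (param \<P> I) (witnesses \<P> I) c' tb \<tau>"
    if "I \<in> instances \<P>" "\<And>i X. tb \<Longrightarrow> X \<subseteq> {..<univ_size \<P> I} \<Longrightarrow> call_time \<O> I i X \<le> \<tau>" for I tb \<tau>
  proof
    show "pmf (answer \<O> I i X) (\<not> (\<exists>W\<in>witnesses \<P> I. W \<subseteq> X)) \<le> c'" if "X \<subseteq> {..<univ_size \<P> I}" for i X
      using assms(2) \<open>I \<in> instances \<P>\<close> that c'(3)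
      unfolding randomised_decision_oracle_def has_witness_def by (meson order_trans)
  qed (use assms(1) that c' in \<open>auto simp: k_witness_problem_def\<close>)
  show ?thesis
  proof (intro exI[of _ "listing_com M"] allI impI conjI)
    fix p q :: nat assume "0 < p" "0 < q"
    let ?run = "\<lambda>I. run \<P> \<O> (listing_com M) I p q"
    show "\<forall>I\<in>instances \<P>. lossless_spmf (?run I) \<and>
       measure (measure_spmf (?run I)) {s. set (listed s) \<subseteq> witnesses \<P> I} \<ge> 1 - real p / real q \<and>
       (verifies_candidates \<P> \<O> I \<longrightarrow> (\<forall>s\<in>set_spmf (?run I). set (listed s) \<subseteq> witnesses \<P> I)) \<and>
       (\<forall>W\<in>witnesses \<P> I. measure (measure_spmf (?run I)) {s. W \<in> set (listed s)} \<ge> 1 - real p / real q)"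
    proof
      fix I assume "I \<in> instances \<P>"
      interpret witness_instance "univ_size \<P> I" "answer \<O> I" "call_time \<O> I" "param \<P> I" "witnesses \<P> I" c' False 0
        by (rule inst[OF \<open>I \<in> instances \<P>\<close>]) simp
      note ens = ensures_listing_com[OF \<open>0 < q\<close> M_le, of p]
      have lossless: "lossless_spmf (?run I)"
        using ens by (simp add: ensures_def run_def)
      have le: "1 - real p / real q \<le> 1 - 1 / real q"
        using \<open>0 < p\<close> \<open>0 < q\<close> by (simp add: field_simps)
      have "1 - 1 / real q \<le> measure (measure_spmf (?run I)) {s. set (listed s) \<subseteq> witnesses \<P> I}"
        using wp_listing_false_positive[OF \<open>0 < q\<close> M_le, of p]
        by (intro measure_spmf_ge_of_nn_integral_le[OF lossless]) (simp_all add: wp_def run_def)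
      moreover have "1 - 1 / real q \<le> measure (measure_spmf (?run I)) {s. W \<in> set (listed s)}"
        if "W \<in> witnesses \<P> I" for W
        using wp_listing_miss[OF \<open>0 < q\<close> M_le that, of p]
        by (intro measure_spmf_ge_of_nn_integral_le[OF lossless]) (simp_all add: wp_def run_def)
      moreover have "\<forall>s\<in>set_spmf (?run I). set (listed s) \<subseteq> witnesses \<P> I" if "verifies_candidates \<P> \<O> I"
        using ens that by (simp add: ensures_def run_def verified_def verifies_candidates_def)
      ultimately show "lossless_spmf (?run I) \<and>
         measure (measure_spmf (?run I)) {s. set (listed s) \<subseteq> witnesses \<P> I} \<ge> 1 - real p / real q \<and>
         (verifies_candidates \<P> \<O> I \<longrightarrow> (\<forall>s\<in>set_spmf (?run I). set (listed s) \<subseteq> witnesses \<P> I)) \<and>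
         (\<forall>W\<in>witnesses \<P> I. measure (measure_spmf (?run I)) {s. W \<in> set (listed s)} \<ge> 1 - real p / real q)"
        using lossless le by (meson order_trans)
    qed
    define K where "K = 640 * real M * real q * (2 * real q + 13)"
    have "0 < K"
      using \<open>0 < M\<close> \<open>0 < q\<close> by (simp add: K_def)
    show "\<exists>f :: nat \<Rightarrow> real. f \<in> O(\<lambda>k. real k) \<and> (\<forall>I\<in>instances \<P>. expected calls (?run I)
        \<le> ennreal (2 powr f (param \<P> I) * log 2 (size' \<P> I) ^ 3 * num_witnesses' \<P> I))"
    proof (intro exI conjI ballI)
      show "(\<lambda>k. log 2 K + 2 * real k) \<in> O(\<lambda>k. real k)"
        by (rule bigo_linear_const)
      fix I assume "I \<in> instances \<P>"
      interpret witness_instance "univ_size \<P> I" "answer \<O> I" "call_time \<O> I" "param \<P> I" "witnesses \<P> I" c' False 0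
        by (rule inst[OF \<open>I \<in> instances \<P>\<close>]) simp
      show "expected calls (?run I)
        \<le> ennreal (2 powr (log 2 K + 2 * real (param \<P> I)) * log 2 (size' \<P> I) ^ 3 * num_witnesses' \<P> I)"
        unfolding powr_linear_const[OF \<open>0 < K\<close>] unfolding expected_def run_def size'_def num_witnesses'_def K_def
        using wp_listing_calls[OF \<open>0 < q\<close> M_le, of p] unfolding wp_def .
    qed
    fix g d
    assume time: "\<forall>I\<in>instances \<P>. \<forall>i. \<forall>X\<subseteq>{..<univ_size \<P> I}. call_time \<O> I i X \<le> g (param \<P> I) * size' \<P> I ^ d"
    define K' where "K' = 3 * real q + 20 + (22 + 4 * real M * (2 * real q + 13)) * 640 * real q"
    have "0 < K'"
      by (simp add: K'_def add_pos_nonneg)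
    show "\<exists>(f :: nat \<Rightarrow> real) e. f \<in> O(\<lambda>k. real k) \<and> (\<forall>I\<in>instances \<P>. expected steps (?run I)
        \<le> ennreal (2 powr f (param \<P> I) * g (param \<P> I) * size' \<P> I ^ e * num_witnesses' \<P> I))"
    proof (intro exI conjI ballI)
      show "(\<lambda>k. log 2 K' + 2 * real k) \<in> O(\<lambda>k. real k)"
        by (rule bigo_linear_const)
      fix I assume I: "I \<in> instances \<P>"
      define \<tau> where "\<tau> = g (param \<P> I) * size' \<P> I ^ d"
      interpret witness_instance "univ_size \<P> I" "answer \<O> I" "call_time \<O> I" "param \<P> I" "witnesses \<P> I" c' True \<tau>
        by (rule inst[OF I]) (use time I in \<open>auto simp: \<tau>_def\<close>)
      \<comment> \<open>Positive call times force \<tau> \<ge> 1, so the steps outside the calls can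
        be charged to \<open>\<tau>\<close> as well.\<close>
      have "0 < call_time \<O> I 0 {}"
        using assms(2) I by (simp add: randomised_decision_oracle_def)
      also have "\<dots> \<le> \<tau>"
        using time I by (simp add: \<tau>_def)
      finally have "1 \<le> \<tau>"
        by simp
      have "real (g (param \<P> I)) * real (size' \<P> I ^ (d + 3)) = real \<tau> * real (max 2 (univ_size \<P> I)) ^ 3"
        by (simp add: \<tau>_def size'_def power_add)
      then have eq: "K' * 4 ^ param \<P> I * real (g (param \<P> I)) * real (size' \<P> I ^ (d + 3)) * num_witnesses' \<P> I =
          K' * 4 ^ param \<P> I * real \<tau> * real (max 2 (univ_size \<P> I)) ^ 3 * num_witnesses' \<P> I"
        by (metis mult.assoc)
      show "expected steps (?run I)
        \<le> ennreal (2 powr (log 2 K' + 2 * real (param \<P> I)) * g (param \<P> I) * size' \<P> I ^ (d + 3) * num_witnesses' \<P> I)"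
        unfolding powr_linear_const[OF \<open>0 < K'\<close>] eq unfolding expected_def run_def num_witnesses'_def K'_def
        using wp_listing_steps[OF \<open>0 < q\<close> M_le TrueI \<open>1 \<le> \<tau>\<close>, of p] unfolding wp_def .
    qed
  qed
qed

end
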